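(* Fix a difference equation $\hat{\boldsymbol\omega}=(1/\hat f,\hat q,\hat w)\in\Omega_N^{\mathbb{R},+}$. Then for each $\mathbf{A}\in\mathcal{B}_{1,4}$, $(\hat{\boldsymbol\omega},\mathbf{A})$ has exactly $N-1$ eigenvalues, and for each $\mathbf{A}\in\mathcal{O}_{1,4}^{\mathbb{C}}\setminus\mathcal{B}_{1,4}$, $(\hat{\boldsymbol\omega},\mathbf{A})$ has exactly $N$ eigenvalues $\lambda_n(\mathbf{A}):=\lambda_n(\hat{\boldsymbol\omega},\mathbf{A})$, $0\le n\le N-1$, which satisfy that: (i) the $\lambda_n(\mathbf{A})$ are continuous in $\mathcal{O}_{1,4}^{\mathbb{C}}\setminus\mathcal{B}_{1,4}$; (ii) the $\lambda_n(\mathbf{A})$ restricted in $\mathcal{B}_{1,4}^+$ and $\mathcal{B}_{1,4}^-$ are always non-decreasing in the $a_{12}$-direction and in the $b_{21}$-direction; (iii) the $\lambda_n(\mathbf{A})$, $0\le n\le N-1$, are not continuous at each point of $\mathcal{B}_{1,4}$ and have the following asymptotic behaviors near any given $\mathbf{A}_0\in\mathcal{B}_{1,4}$: $$\lim_{\mathcal{B}_{1,4}^-\cup\mathcal{B}_{1,4}\ni\mathbf{A}\to\mathbf{A}_0}\lambda_n(\mathbf{A})=\lambda_n(\mathbf{A}_0),\ 0\le n\le N-2,\qquad \lim_{\mathcal{B}_{1,4}^-\ni\mathbf{A}\to\mathbf{A}_0}\lambda_{N-1}(\mathbf{A})=+\infty,$$ $$\lim_{\mathcal{B}_{1,4}^+\ni\mathbf{A}\to\mathbf{A}_0}\lambda_0(\mathbf{A})=-\infty,\qquad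 \lim_{\mathcal{B}_{1,4}^+\ni\mathbf{A}\to\mathbf{A}_0}\lambda_n(\mathbf{A})=\lambda_{n-1}(\mathbf{A}_0),\ 1\le n\le N-1.$$ Consequently, $\lambda_n(\mathbf{A})$ restricted in $\mathcal{B}_{1,4}^-\cup\mathcal{B}_{1,4}$ is continuous for each $0\le n\le N-2$.
   Context: Fix an integer $N\ge 2$. A self-adjoint discrete Sturm–Liouville problem is a pair $(\boldsymbol\omega,\mathbf{A})$. Here $\boldsymbol\omega=(1/f,q,w)$ with real sequences $f=\{f_n\}_{n=0}^N$, $q=\{q_n\}_{n=1}^N$, $w=\{w_n\}_{n=1}^N$, $f_n\ne0$, $w_n>0$, encodes the equation $-\nabla(f_n\Delta y_n)+q_ny_n=\lambda w_ny_n$, $1\le n\le N$, for $y=(y_0,\dots,y_{N+1})$, with $\Delta y_n=y_{n+1}-y_n$, $\nabla y_n=y_n-y_{n-1}$; $\Omega_N^{\mathbb{R},+}\subset\mathbb{R}^{3N+1}$ is the set of all such $(1/f,q,w)$. $\mathbf{A}=[A\,|\,B]$ encodes the boundary condition $A\begin{pmatrix}y_0\\ f_0\Delta y_0\end{pmatrix}+B\begin{pmatrix}y_N\\ f_N\Delta y_N\end{pmatrix}=0$, where $A,B$ are complex $2\times2$ matrices with $\mathrm{rank}(A,B)=2$ and $AJA^*=BJB^*$, $J=\begin{pmatrix}0&1\\-1&0\end{pmatrix}$; $[A\,|\,B]$ is the class of the $2\times4$ matrix $(A,B)$ modulo left multiplication by $GL(2,\mathbb{C})$, and $\mathcal{B}^{\mathbb{C}}$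 is the set of all such classes, topologized as a subspace of the quotient of the rank-2 complex $2\times4$ matrices by $GL(2,\mathbb{C})$. An eigenvalue of $(\boldsymbol\omega,\mathbf{A})$ is a $\lambda$ for which a nonzero $y$ solves the equation and the boundary condition. Eigenvalues are real and finite in number; they are counted with multiplicity (the dimension of the solution space) and listed as $\lambda_0\le\lambda_1\le\cdots$; $\lambda_n$ is defined at a problem only if it has more than $n$ eigenvalues, and $\lambda_n$ is regarded as not continuous at a point where it is not defined. $\mathcal{O}_{1,4}^{\mathbb{C}}=\left\{\left[\begin{array}{cccc}1&a_{12}&\bar z&0\\0&z&b_{21}&1\end{array}\right]:a_{12},b_{21}\in\mathbb{R},\ z\in\mathbb{C}\right\}$, an open subset of $\mathcal{B}^{\mathbb{C}}$ with coordinates $(a_{12},\mathrm{Re}\,z,\mathrm{Im}\,z,b_{21})$ identifying it with $\mathbb{R}^4$. For the fixed $\hat{\boldsymbol\omega}$, $\mathcal{B}_{1,4}$, $\mathcal{B}_{1,4}^+$, $\mathcal{B}_{1,4}^-$ are the sets of $\mathbf{A}\in\mathcal{O}_{1,4}^{\mathbb{C}}$ with $a_{12}=1/\hat f_0$, $a_{12}>1/\hat f_0$, $a_{12}<1/\hat f_0$, respectively. Monotone in a coordinate direction means with the other coordinates fixed.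
   Formalization: In (iii), non-continuity of λ_n at A_0 in B_{1,4} is claimed for n=0, n=N-1, or when λ_{n-1}(A_0)≠λ_n(A_0); if these coincide λ_n is continuous at A_0 (e.g. N=3, f=w=1, q=0, a_12=z=1, b_21=2, n=1). Also, each λ_n is shown not continuous at some point of B_{1,4}. *)

theory Defs
  imports "HOL-Analysis.Analysis" "HOL-Library.Function_Algebras"
begin

section \<open>Boundary conditions\<close>

definition adjoint_mat :: "complex^'n^'m \<Rightarrow> complex^'m^'n" where
  "adjoint_mat M = (\<chi> i j. cnj (M $ j $ i))"

definition J2 :: "complex^2^2" where
  "J2 = vector [vector [0, 1], vector [-1, 0]]"

text \<open>A \<open>2 \<times> 4\<close> matrix \<open>M\<close> stands for the pair \<open>(A, B)\<close> of its \<open>2 \<times> 2\<close> blocks.\<close>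

definition blockA :: "complex^4^2 \<Rightarrow> complex^2^2" where
  "blockA M = (\<chi> i. vector [M $ i $ 1, M $ i $ 2])"

definition blockB :: "complex^4^2 \<Rightarrow> complex^2^2" where
  "blockB M = (\<chi> i. vector [M $ i $ 3, M $ i $ 4])"

definition rank2_mats :: "(complex^4^2) set" where
  "rank2_mats = {M. rank M = 2}"

definition bc_class :: "complex^4^2 \<Rightarrow> (complex^4^2) set" where
  "bc_class M = {T ** M | T :: complex^2^2. invertible T}"

definition self_adjoint_bcs :: "(complex^4^2) set set" where
  "self_adjoint_bcs = bc_class ` {M \<in> rank2_mats.
     blockA M ** J2 ** adjoint_mat (blockA M) = blockB M ** J2 ** adjoint_mat (blockB M)}"

definition bc_quotient_topology :: "(complex^4^2) set topology" where
  "bc_quotient_topology = topology (\<lambda>U. U \<subseteq> bc_class ` rank2_mats \<and>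
     openin (top_of_set rank2_mats) {M \<in> rank2_mats. bc_class M \<in> U})"

definition bc_topology :: "(complex^4^2) set topology" where
  "bc_topology = subtopology bc_quotient_topology self_adjoint_bcs"

lemma openin_bc_quotient_topology:
  "openin bc_quotient_topology U \<longleftrightarrow> U \<subseteq> bc_class ` rank2_mats \<and>
     openin (top_of_set rank2_mats) {M \<in> rank2_mats. bc_class M \<in> U}"
proof -
  have "istopology (\<lambda>U. U \<subseteq> bc_class ` rank2_mats \<and>
     openin (top_of_set rank2_mats) {M \<in> rank2_mats. bc_class M \<in> U})"
    unfolding istopology_def
  proof (intro conjI allI impI; (elim conjE)?)
    fix S T :: "(complex^4^2) set set"
    assume "openin (top_of_set rank2_mats) {M \<in> rank2_mats. bc_class M \<in> S}"
      and "openin (top_of_set rank2_mats) {M \<in> rank2_mats. bc_class M \<in> T}"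
    moreover have "{M \<in> rank2_mats. bc_class M \<in> S \<inter> T} =
        {M \<in> rank2_mats. bc_class M \<in> S} \<inter> {M \<in> rank2_mats. bc_class M \<in> T}"
      by auto
    ultimately show "openin (top_of_set rank2_mats) {M \<in> rank2_mats. bc_class M \<in> S \<inter> T}"
      by (simp only: openin_Int)
  next
    fix K :: "(complex^4^2) set set set"
    assume K: "\<forall>S\<in>K. S \<subseteq> bc_class ` rank2_mats \<and>
      openin (top_of_set rank2_mats) {M \<in> rank2_mats. bc_class M \<in> S}"
    then show "\<Union>K \<subseteq> bc_class ` rank2_mats" by blast
    have "{M \<in> rank2_mats. bc_class M \<in> \<Union>K} =
        (\<Union>S\<in>K. {M \<in> rank2_mats. bc_class M \<in> S})"
      by auto
    with K show "openin (top_of_set rank2_mats) {M \<in> rank2_mats. bc_class M \<in> \<Union>K}"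
      by (simp only:) (rule openin_Union, blast)
  qed auto
  then show ?thesis
    by (simp add: bc_quotient_topology_def)
qed

lemma topspace_bc_quotient_topology:
  "topspace bc_quotient_topology = bc_class ` rank2_mats"
proof
  show "topspace bc_quotient_topology \<subseteq> bc_class ` rank2_mats"
    unfolding topspace_def openin_bc_quotient_topology by blast
  have "{M \<in> rank2_mats. bc_class M \<in> bc_class ` rank2_mats} = rank2_mats"
    by auto
  then have "openin bc_quotient_topology (bc_class ` rank2_mats)"
    by (simp add: openin_bc_quotient_topology)
  then show "bc_class ` rank2_mats \<subseteq> topspace bc_quotient_topology"
    by (rule openin_subset)
qed

lemma quotient_map_bc_class:
  "quotient_map (top_of_set rank2_mats) bc_quotient_topology bc_class"
  by (auto simp: quotient_map_def topspace_bc_quotient_topology openin_bc_quotient_topology)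


section \<open>The chart \<open>O\<close> and its subsets\<close>

definition chart_mat :: "real \<Rightarrow> complex \<Rightarrow> real \<Rightarrow> complex^4^2" where
  "chart_mat a12 z b21 =
     vector [vector [1, of_real a12, cnj z, 0],
             vector [0, z, of_real b21, 1]]"

definition chart :: "real \<Rightarrow> complex \<Rightarrow> real \<Rightarrow> (complex^4^2) set" where
  "chart a12 z b21 = bc_class (chart_mat a12 z b21)"

definition O14 :: "(complex^4^2) set set" where
  "O14 = {chart a12 z b21 | a12 z b21. True}"

definition B14 :: "(nat \<Rightarrow> real) \<Rightarrow> (complex^4^2) set set" where
  "B14 f = {chart a12 z b21 | a12 z b21. a12 = 1 / f 0}"

definition B14_plus :: "(nat \<Rightarrow> real) \<Rightarrow> (complex^4^2) set set" where
  "B14_plus f = {chart a12 z b21 | a12 z b21. a12 > 1 / f 0}"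

definition B14_minus :: "(nat \<Rightarrow> real) \<Rightarrow> (complex^4^2) set set" where
  "B14_minus f = {chart a12 z b21 | a12 z b21. a12 < 1 / f 0}"


section \<open>Eigenvalues\<close>

global_interpretation cseq: vector_space "\<lambda>(c::complex) (y::nat \<Rightarrow> complex) n. c * y n"
  by unfold_locales (auto simp: fun_eq_iff algebra_simps)

text \<open>The coefficients are functions on \<open>nat\<close>, of which only \<open>f 0, \<dots>, f N\<close>, \<open>q 1, \<dots>, q N\<close>
  and \<open>w 1, \<dots>, w N\<close> matter.\<close>

definition solves_equation ::
  "nat \<Rightarrow> (nat \<Rightarrow> real) \<Rightarrow> (nat \<Rightarrow> real) \<Rightarrow> (nat \<Rightarrow> real) \<Rightarrow> complex \<Rightarrow> (nat \<Rightarrow> complex) \<Rightarrow> bool" where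
  "solves_equation N f q w l y \<longleftrightarrow>
     (\<forall>n\<in>{1..N}.
        - (of_real (f n) * (y (n + 1) - y n) - of_real (f (n - 1)) * (y n - y (n - 1)))
          + of_real (q n) * y n = l * of_real (w n) * y n)"

text \<open>The boundary condition does not depend on the representative \<open>M\<close> of the class \<open>C\<close>.\<close>

definition satisfies_bc ::
  "nat \<Rightarrow> (nat \<Rightarrow> real) \<Rightarrow> (complex^4^2) set \<Rightarrow> (nat \<Rightarrow> complex) \<Rightarrow> bool" where
  "satisfies_bc N f C y \<longleftrightarrow>
     (\<forall>M\<in>C. blockA M *v vector [y 0, of_real (f 0) * (y 1 - y 0)]
            + blockB M *v vector [y N, of_real (f N) * (y (N + 1) - y N)] = 0)"

text \<open>A vector \<open>(y\<^sub>0, \<dots>, y\<^sub>N\<^sub>+\<^sub>1)\<close> is represented by its extension by zero to \<open>nat\<close>.\<close>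

definition eigenspace ::
  "nat \<Rightarrow> (nat \<Rightarrow> real) \<Rightarrow> (nat \<Rightarrow> real) \<Rightarrow> (nat \<Rightarrow> real) \<Rightarrow> (complex^4^2) set \<Rightarrow> complex
     \<Rightarrow> (nat \<Rightarrow> complex) set" where
  "eigenspace N f q w C l =
     {y. (\<forall>n > N + 1. y n = 0) \<and> solves_equation N f q w l y \<and> satisfies_bc N f C y}"

definition eigenvalues ::
  "nat \<Rightarrow> (nat \<Rightarrow> real) \<Rightarrow> (nat \<Rightarrow> real) \<Rightarrow> (nat \<Rightarrow> real) \<Rightarrow> (complex^4^2) set \<Rightarrow> complex set" where
  "eigenvalues N f q w C = {l. \<exists>y \<in> eigenspace N f q w C l. \<exists>n. y n \<noteq> 0}"

definition multiplicity_of ::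
  "nat \<Rightarrow> (nat \<Rightarrow> real) \<Rightarrow> (nat \<Rightarrow> real) \<Rightarrow> (nat \<Rightarrow> real) \<Rightarrow> (complex^4^2) set \<Rightarrow> complex \<Rightarrow> nat" where
  "multiplicity_of N f q w C l = cseq.dim (eigenspace N f q w C l)"

definition has_exactly_eigenvalues ::
  "nat \<Rightarrow> (nat \<Rightarrow> real) \<Rightarrow> (nat \<Rightarrow> real) \<Rightarrow> (nat \<Rightarrow> real) \<Rightarrow> (complex^4^2) set \<Rightarrow> nat \<Rightarrow> bool" where
  "has_exactly_eigenvalues N f q w C k \<longleftrightarrow>
     finite (eigenvalues N f q w C) \<and> eigenvalues N f q w C \<subseteq> \<real> \<and>
     (\<Sum>l\<in>eigenvalues N f q w C. multiplicity_of N f q w C l) = k"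

text \<open>The increasing list of eigenvalues, each repeated according to its multiplicity.\<close>

definition eigenvalue_list ::
  "nat \<Rightarrow> (nat \<Rightarrow> real) \<Rightarrow> (nat \<Rightarrow> real) \<Rightarrow> (nat \<Rightarrow> real) \<Rightarrow> (complex^4^2) set \<Rightarrow> real list" where
  "eigenvalue_list N f q w C =
     concat (map (\<lambda>r. replicate (multiplicity_of N f q w C (of_real r)) r)
       (sorted_list_of_set {r. of_real r \<in> eigenvalues N f q w C}))"

text \<open>The value of \<open>eigval n\<close> is meaningful only on \<open>eigval_domain n\<close>.\<close>

definition eigval ::
  "nat \<Rightarrow> (nat \<Rightarrow> real) \<Rightarrow> (nat \<Rightarrow> real) \<Rightarrow> (nat \<Rightarrow> real) \<Rightarrow> nat \<Rightarrow> (complex^4^2) set \<Rightarrow> real" where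
  "eigval N f q w n C = eigenvalue_list N f q w C ! n"

definition eigval_domain ::
  "nat \<Rightarrow> (nat \<Rightarrow> real) \<Rightarrow> (nat \<Rightarrow> real) \<Rightarrow> (nat \<Rightarrow> real) \<Rightarrow> nat \<Rightarrow> (complex^4^2) set set" where
  "eigval_domain N f q w n = {C \<in> self_adjoint_bcs. n < length (eigenvalue_list N f q w C)}"

text \<open>Continuity at \<open>C\<close> of the partial function \<open>eigval n\<close> on the space of boundary conditions;
  it fails where the function is not defined. At a point of \<open>B14\<close> with a double eigenvalue
  \<open>\<lambda>\<^sub>n\<^sub>-\<^sub>1 = \<lambda>\<^sub>n\<close> the limits of \<open>\<lambda>\<^sub>n\<close> from the two sides agree, so that \<open>\<lambda>\<^sub>n\<close> is continuous there;
  this is why a claim of discontinuity at a given point of \<open>B14\<close> has to exclude this case.\<close>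

definition eigval_continuous_at ::
  "nat \<Rightarrow> (nat \<Rightarrow> real) \<Rightarrow> (nat \<Rightarrow> real) \<Rightarrow> (nat \<Rightarrow> real) \<Rightarrow> nat \<Rightarrow> (complex^4^2) set \<Rightarrow> bool" where
  "eigval_continuous_at N f q w n C \<longleftrightarrow>
     topcontinuous_at (subtopology bc_topology (eigval_domain N f q w n)) euclideanreal
       (eigval N f q w n) C"

end

theory Submission
  imports Defs
begin

text \<open>Put \<open>x\<^sub>1 = y\<^sub>1 + cnj z * y\<^sub>N\<close> and \<open>x\<^sub>n = y\<^sub>n\<close> for \<open>2 \<le> n \<le> N\<close>, and let \<open>c = a\<^sub>1\<^sub>2 - 1 / f\<^sub>0\<close>. The first row of the
  boundary condition becomes \<open>x\<^sub>1 = - c f\<^sub>0 \<Delta> y\<^sub>0\<close>, and summation by parts turns the problem into a Hermitian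
  pencil. For \<open>c \<noteq> 0\<close> it lives on \<open>\<complex>\<^sup>N\<close> and its form is \<open>R + s \<bar>x\<^sub>1\<bar>\<^sup>2\<close> with \<open>s = - 1 / c\<close>, where \<open>R\<close> and the weight depend
  continuously on \<open>z\<close> and \<open>b\<^sub>2\<^sub>1\<close>; for \<open>c = 0\<close> it is the restriction of \<open>R\<close> to the hyperplane \<open>x\<^sub>1 = 0\<close>, with
  \<open>f\<^sub>0 \<Delta> y\<^sub>0\<close> as Lagrange multiplier. By the min-max principle the eigenvalues are continuous and increase with
  \<open>s\<close> and \<open>b\<^sub>2\<^sub>1\<close>. As \<open>s \<rightarrow> \<infinity>\<close> (that is, \<open>c \<rightarrow> 0\<close> from below) the penalty \<open>s \<bar>x\<^sub>1\<bar>\<^sup>2\<close> enforces \<open>x\<^sub>1 = 0\<close>: the top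
  eigenvalue escapes to \<open>\<infinity>\<close> and the others tend to those of the restricted pencil. The case \<open>s \<rightarrow> -\<infinity>\<close>
  follows by changing the sign of the form.\<close>

section \<open>Hermitian pencils on finitely supported vectors\<close>

text \<open>Near a boundary condition with \<open>c = 0\<close> the parameter \<open>s\<close>
  diverges while \<open>z\<close> and \<open>b\<close> move as well, so a limit in \<open>s\<close>
  for fixed forms does not suffice. The eigenvalue is therefore enclosed between quantities in which
  \<open>s\<close> no longer moves. From above: vectors with \<open>x 1 = 0\<close> do not see the
  penalty, so the restricted eigenvalues are bounds for every \<open>s\<close>. From below:
  eigenvalues increase with \<open>s\<close>, hence \<open>s\<close> may be frozen at one large
  value chosen for the limit forms alone, and continuity at that fixed value applies. The
  coefficient \<open>- 1 / c\<close> has this origin: testing the equation with \<open>v\<close>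
  leaves the single boundary term \<open>p * cnj (v 1)\<close> with \<open>p\<close> standing for
  \<open>f 0 * (y 1 - y 0)\<close>, and the first row says \<open>p = - x 1 / c\<close>. Vectors are
  functions on all of \<open>nat\<close> supported in a finite index set, so passing to the
  hyperplane keeps the forms and only replaces \<open>{1..N}\<close> by
  \<open>{2..N}\<close>.\<close>

definition vecs_on :: "nat set \<Rightarrow> (nat \<Rightarrow> complex) set" where
  "vecs_on I = {x. \<forall>n. n \<notin> I \<longrightarrow> x n = 0}"

definition unit_vec :: "nat \<Rightarrow> nat \<Rightarrow> complex" where
  "unit_vec i n = (if n = i then 1 else 0)"

definition hermitian_form :: "((nat \<Rightarrow> complex) \<Rightarrow> (nat \<Rightarrow> complex) \<Rightarrow> complex) \<Rightarrow> bool" where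
  "hermitian_form Q \<longleftrightarrow>
     (\<forall>x y z. Q (x + y) z = Q x z + Q y z) \<and>
     (\<forall>c x z. Q (\<lambda>n. c * x n) z = c * Q x z) \<and>
     (\<forall>x y. Q y x = cnj (Q x y))"

definition qf :: "((nat \<Rightarrow> complex) \<Rightarrow> (nat \<Rightarrow> complex) \<Rightarrow> complex) \<Rightarrow> (nat \<Rightarrow> complex) \<Rightarrow> real" where
  "qf Q x = Re (Q x x)"

text \<open>Gaussian elimination, by induction on the number of equations. Underlies the dimension
  counts of the min-max arguments: a space of dimension \<open>m + 1\<close> meets every space cut
  out by \<open>m\<close> linear conditions.\<close>

lemma homogeneous_system_solution:
  fixes a :: "'i \<Rightarrow> 'j \<Rightarrow> 'k::field"
  assumes "finite K" "finite J" "card K < card J"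
  shows "\<exists>c. (\<exists>j\<in>J. c j \<noteq> 0) \<and> (\<forall>i\<in>K. (\<Sum>j\<in>J. c j * a i j) = 0)"
  using assms
proof (induction K arbitrary: J a rule: finite_induct)
  case empty
  then have "J \<noteq> {}" by auto
  then show ?case by (intro exI[of _ "\<lambda>_. 1"]) auto
next
  case (insert k K)
  show ?case
  proof (cases "\<forall>j\<in>J. a k j = 0")
    case True
    obtain c where "\<exists>j\<in>J. c j \<noteq> 0" "\<forall>i\<in>K. (\<Sum>j\<in>J. c j * a i j) = 0"
      using insert.IH[of J a] insert.prems insert.hyps by auto
    with True show ?thesis by (intro exI[of _ c]) auto
  next
    case False
    then obtain p where p: "p \<in> J" "a k p \<noteq> 0" by blast
    define J' where "J' = J - {p}"
    have J': "finite J'" "card K < card J'" "p \<notin> J'" "J = insert p J'"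
      using insert.prems insert.hyps p by (auto simp: J'_def)
    \<comment> \<open>Coefficients after equation \<open>k\<close> has been used to eliminate the
      unknown \<open>p\<close>.\<close>
    define a' where "a' i j = a i j - a k j * a i p / a k p" for i j
    obtain c where c: "\<exists>j\<in>J'. c j \<noteq> 0" "\<forall>i\<in>K. (\<Sum>j\<in>J'. c j * a' i j) = 0"
      using insert.IH[of J' a'] J' by auto
    \<comment> \<open>Back substitution: the value at \<open>p\<close> is the one that solves
      equation \<open>k\<close>.\<close>
    define d where "d = c(p := - (\<Sum>j\<in>J'. c j * a k j) / a k p)"
    have eq: "(\<Sum>j\<in>J. d j * a i j) = d p * a i p + (\<Sum>j\<in>J'. c j * a i j)" for i
    proof -
      have "(\<Sum>j\<in>J'. d j * a i j) = (\<Sum>j\<in>J'. c j * a i j)"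
        using J'(3) by (intro sum.cong) (auto simp: d_def)
      then show ?thesis using J' by simp
    qed
    have "(\<Sum>j\<in>J. d j * a k j) = 0"
      unfolding eq using p by (simp add: d_def)
    moreover have "(\<Sum>j\<in>J. d j * a i j) = 0" if "i \<in> K" for i
    proof -
      have "(\<Sum>j\<in>J'. c j * a' i j) =
          (\<Sum>j\<in>J'. c j * a i j) - (\<Sum>j\<in>J'. c j * a k j) * (a i p / a k p)"
        by (simp add: a'_def algebra_simps sum_subtractf sum_distrib_left sum_distrib_right)
      with c(2) that show ?thesis
        unfolding eq by (simp add: d_def)
    qed
    moreover have "\<exists>j\<in>J. d j \<noteq> 0"
      using c(1) J' by (auto simp: d_def)
    ultimately show ?thesis by (intro exI[of _ d]) auto
  qed
qed

section \<open>Algebra of Hermitian forms and their expansion in unit vectors\<close>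

lemma hermitian_formI:
  assumes "\<And>x y z. Q (x + y) z = Q x z + Q y z" "\<And>c x z. Q (\<lambda>n. c * x n) z = c * Q x z"
    "\<And>x y. Q y x = cnj (Q x y)"
  shows "hermitian_form Q"
  using assms unfolding hermitian_form_def by blast

lemma hermitian_add: "hermitian_form Q \<Longrightarrow> Q (x + y) z = Q x z + Q y z"
  and hermitian_scale: "hermitian_form Q \<Longrightarrow> Q (\<lambda>n. c * x n) z = c * Q x z"
  and hermitian_cnj: "hermitian_form Q \<Longrightarrow> Q y x = cnj (Q x y)"
  unfolding hermitian_form_def by blast+

lemma hermitian_add_right: "hermitian_form Q \<Longrightarrow> Q z (x + y) = Q z x + Q z y"
  by (metis complex_cnj_add hermitian_add hermitian_cnj)

lemma hermitian_scale_right: "hermitian_form Q \<Longrightarrow> Q z (\<lambda>n. c * x n) = cnj c * Q z x"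
  by (metis complex_cnj_mult hermitian_scale hermitian_cnj)

lemma hermitian_zero: assumes "hermitian_form Q" shows "Q 0 z = 0" "Q z 0 = 0"
proof -
  show "Q 0 z = 0" using hermitian_scale[OF assms, of 0 0 z] by (simp add: zero_fun_def)
  then show "Q z 0 = 0" using hermitian_cnj[OF assms, of z 0] by simp
qed

lemma hermitian_sum:
  assumes "hermitian_form Q" "finite J"
  shows "Q (\<lambda>n. \<Sum>j\<in>J. c j * g j n) z = (\<Sum>j\<in>J. c j * Q (g j) z)"
  using assms(2)
proof (induction J rule: finite_induct)
  case empty
  then show ?case using hermitian_zero[OF assms(1)] by (simp add: zero_fun_def)
next
  case (insert a J)
  have "(\<lambda>n. \<Sum>j\<in>insert a J. c j * g j n) = (\<lambda>n. c a * g a n) + (\<lambda>n. \<Sum>j\<in>J. c j * g j n)"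
    using insert by (auto simp: fun_eq_iff)
  then show ?case
    using insert by (simp add: hermitian_add[OF assms(1)] hermitian_scale[OF assms(1)])
qed

lemma hermitian_sum_right:
  assumes "hermitian_form Q" "finite J"
  shows "Q z (\<lambda>n. \<Sum>j\<in>J. c j * g j n) = (\<Sum>j\<in>J. cnj (c j) * Q z (g j))"
  unfolding hermitian_cnj[OF assms(1), of z] hermitian_sum[OF assms] cnj_sum
  by (intro sum.cong) (auto simp: hermitian_cnj[OF assms(1), of z])

lemma hermitian_self: "hermitian_form Q \<Longrightarrow> Q x x = of_real (qf Q x)"
  by (metis Reals_cnj_iff complex_is_Real_iff hermitian_cnj of_real_Re qf_def)

lemma hermitian_comb:
  assumes "hermitian_form Q" "hermitian_form R"
  shows "hermitian_form (\<lambda>x y. Q x y + of_real s * R x y)"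
  by (intro hermitian_formI; (simp add: assms hermitian_add hermitian_scale algebra_simps)?)
     (metis assms complex_cnj_add complex_cnj_complex_of_real complex_cnj_mult hermitian_cnj)

lemma hermitian_uminus:
  assumes "hermitian_form Q"
  shows "hermitian_form (\<lambda>x y. - Q x y)"
  by (intro hermitian_formI; (simp add: assms hermitian_add hermitian_scale algebra_simps)?)
     (metis assms complex_cnj_minus hermitian_cnj)

lemma qf_comb: "qf (\<lambda>x y. Q x y + of_real s * R x y) x = qf Q x + s * qf R x"
  by (simp add: qf_def)

lemma qf_uminus: "qf (\<lambda>x y. - Q x y) x = - qf Q x"
  by (simp add: qf_def)

lemma qf_scale: "hermitian_form Q \<Longrightarrow> qf Q (\<lambda>n. c * x n) = (cmod c)\<^sup>2 * qf Q x"
proof -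
  assume h: "hermitian_form Q"
  have "Q (\<lambda>n. c * x n) (\<lambda>n. c * x n) = (c * cnj c) * Q x x"
    by (simp add: hermitian_scale[OF h] hermitian_scale_right[OF h] mult_ac)
  then show ?thesis
    by (simp add: qf_def flip: complex_norm_square)
qed

lemma qf_add:
  assumes "hermitian_form Q"
  shows "qf Q (x + y) = qf Q x + 2 * Re (Q x y) + qf Q y"
  using hermitian_cnj[OF assms, of x y]
  by (simp add: qf_def hermitian_add[OF assms] hermitian_add_right[OF assms])

lemma vecs_on_mono: "I \<subseteq> I' \<Longrightarrow> vecs_on I \<subseteq> vecs_on I'"
  by (auto simp: vecs_on_def)

lemma vecs_on_sum: "(\<And>j. j \<in> J \<Longrightarrow> g j \<in> vecs_on I) \<Longrightarrow> (\<lambda>n. \<Sum>j\<in>J. c j * g j n) \<in> vecs_on I"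
  by (auto simp: vecs_on_def)

lemma vecs_on_add: "x \<in> vecs_on I \<Longrightarrow> y \<in> vecs_on I \<Longrightarrow> x + y \<in> vecs_on I"
  by (auto simp: vecs_on_def)

lemma vecs_on_scale: "x \<in> vecs_on I \<Longrightarrow> (\<lambda>n. c * x n) \<in> vecs_on I"
  by (auto simp: vecs_on_def)

lemma unit_vec_vecs_on: "i \<in> I \<Longrightarrow> unit_vec i \<in> vecs_on I"
  by (auto simp: vecs_on_def unit_vec_def)

lemma vecs_on_expand:
  assumes "finite I" "x \<in> vecs_on I"
  shows "x = (\<lambda>n. \<Sum>i\<in>I. x i * unit_vec i n)"
  using assms by (auto simp: fun_eq_iff vecs_on_def unit_vec_def if_distrib cong: if_cong)

lemma hermitian_expand_left:
  assumes "hermitian_form Q" "finite I" "x \<in> vecs_on I"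
  shows "Q x y = (\<Sum>i\<in>I. x i * Q (unit_vec i) y)"
  by (subst vecs_on_expand[OF assms(2,3)], subst hermitian_sum[OF assms(1,2)]) simp

lemma hermitian_expand:
  assumes "hermitian_form Q" "finite I" "x \<in> vecs_on I"
  shows "Q x x = (\<Sum>i\<in>I. \<Sum>j\<in>I. x i * cnj (x j) * Q (unit_vec i) (unit_vec j))"
proof -
  have "Q (unit_vec i) x = (\<Sum>j\<in>I. cnj (x j) * Q (unit_vec i) (unit_vec j))" for i
    by (subst vecs_on_expand[OF assms(2,3)], subst hermitian_sum_right[OF assms(1,2)]) simp
  then show ?thesis
    unfolding hermitian_expand_left[OF assms, of x] by (simp add: sum_distrib_left mult_ac)
qed

section \<open>Norm estimates, compactness of spheres and coercivity\<close>

definition sqnorm :: "nat set \<Rightarrow> (nat \<Rightarrow> complex) \<Rightarrow> real" where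
  "sqnorm I x = (\<Sum>i\<in>I. (cmod (x i))\<^sup>2)"

lemma sqnorm_nonneg: "0 \<le> sqnorm I x"
  by (simp add: sqnorm_def sum_nonneg)

lemma sqnorm_pos: "finite I \<Longrightarrow> x \<in> vecs_on I \<Longrightarrow> x \<noteq> 0 \<Longrightarrow> 0 < sqnorm I x"
  unfolding sqnorm_def vecs_on_def by (fastforce simp: fun_eq_iff intro: sum_pos2)

lemma sqnorm_scale: "sqnorm I (\<lambda>n. c * x n) = (cmod c)\<^sup>2 * sqnorm I x"
  by (simp add: sqnorm_def norm_mult power_mult_distrib sum_distrib_left)

lemma component_le_sqnorm: "finite I \<Longrightarrow> i \<in> I \<Longrightarrow> (cmod (x i))\<^sup>2 \<le> sqnorm I x"
  unfolding sqnorm_def by (rule member_le_sum) auto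

text \<open>The constant is crude but consists of the entries of the form on unit vectors. Applied
  to a difference of forms, it turns entrywise convergence into closeness that is uniform on the
  sphere.\<close>

lemma qf_le_sqnorm:
  assumes "hermitian_form Q" "finite I" "x \<in> vecs_on I"
  shows "\<bar>qf Q x\<bar> \<le> (\<Sum>i\<in>I. \<Sum>j\<in>I. cmod (Q (unit_vec i) (unit_vec j))) * sqnorm I x"
proof -
  have "\<bar>qf Q x\<bar> \<le> cmod (Q x x)" unfolding qf_def by (rule abs_Re_le_cmod)
  also have "\<dots> \<le> (\<Sum>i\<in>I. \<Sum>j\<in>I. cmod (x i * cnj (x j) * Q (unit_vec i) (unit_vec j)))"
    unfolding hermitian_expand[OF assms] by (intro sum_norm_le order_refl)
  also have "\<dots> \<le> (\<Sum>i\<in>I. \<Sum>j\<in>I. sqnorm I x * cmod (Q (unit_vec i) (unit_vec j)))"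
  proof (intro sum_mono)
    fix i j assume ij: "i \<in> I" "j \<in> I"
    have "cmod (x i) * cmod (x j) \<le> ((cmod (x i))\<^sup>2 + (cmod (x j))\<^sup>2) / 2"
      using sum_squares_bound[of "cmod (x i)" "cmod (x j)"] by simp
    also have "\<dots> \<le> sqnorm I x"
      using component_le_sqnorm[OF assms(2) ij(1), of x] component_le_sqnorm[OF assms(2) ij(2), of x] by simp
    finally show "cmod (x i * cnj (x j) * Q (unit_vec i) (unit_vec j))
        \<le> sqnorm I x * cmod (Q (unit_vec i) (unit_vec j))"
      by (simp add: norm_mult mult_right_mono)
  qed
  also have "\<dots> = (\<Sum>i\<in>I. \<Sum>j\<in>I. cmod (Q (unit_vec i) (unit_vec j))) * sqnorm I x"
    by (simp add: sum_distrib_left sum_distrib_right mult_ac)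
  finally show ?thesis .
qed

lemma sqnorm_normalized:
  assumes "finite I" "x \<in> vecs_on I" "x \<noteq> 0"
  shows "sqnorm I (\<lambda>n. of_real (1 / sqrt (sqnorm I x)) * x n) = 1"
  unfolding sqnorm_scale using sqnorm_pos[OF assms] by (simp add: norm_divide power_divide)

definition pencil where
  "pencil I Q P \<longleftrightarrow> finite I \<and> hermitian_form Q \<and> hermitian_form P \<and>
     (\<forall>x\<in>vecs_on I. x \<noteq> 0 \<longrightarrow> 0 < qf P x)"

lemma pencilD:
  assumes "pencil I Q P"
  shows "finite I" "hermitian_form Q" "hermitian_form P"
    "\<And>x. x \<in> vecs_on I \<Longrightarrow> x \<noteq> 0 \<Longrightarrow> 0 < qf P x"
    "\<And>x. x \<in> vecs_on I \<Longrightarrow> 0 \<le> qf P x"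
proof -
  show 4: "0 < qf P x" if "x \<in> vecs_on I" "x \<noteq> 0" for x
    using assms that unfolding pencil_def by blast
  show 3: "finite I" "hermitian_form Q" "hermitian_form P"
    using assms unfolding pencil_def by blast+
  show "0 \<le> qf P x" if "x \<in> vecs_on I" for x
    using 4[OF that] hermitian_zero[OF 3(3)] by (cases "x = 0") (auto simp: qf_def)
qed

lemma pencil_subset: "pencil I Q P \<Longrightarrow> I' \<subseteq> I \<Longrightarrow> pencil I' Q P"
  unfolding pencil_def using vecs_on_mono[of I' I] finite_subset[of I' I] by auto

lemma pencil_uminus: "pencil I Q P \<Longrightarrow> pencil I (\<lambda>x y. - Q x y) P"
  unfolding pencil_def by (simp add: hermitian_uminus)

text \<open>Compactness comes from Tychonoff's theorem in the product topology: the set is a closed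
  subset of a product of unit discs over \<open>I\<close> and of \<open>{0}\<close> elsewhere. The
  linear equations make it usable for spheres in orthogonal complements; \<open>m = 0\<close> is the
  full sphere.\<close>

lemma compact_sphere:
  assumes "finite I"
  shows "compact {x \<in> vecs_on I. sqnorm I x = 1 \<and> (\<forall>i<m::nat. (\<Sum>j\<in>I. x j * d i j) = 0)}"
proof -
  define K where "K = (PiE UNIV (\<lambda>i. if i \<in> I then cball 0 1 else {0}) :: (nat \<Rightarrow> complex) set)"
  have "compact K"
    unfolding K_def compactin_euclidean_iff[symmetric] euclidean_product_topology[symmetric]
    by (rule compactin_PiE[THEN iffD2]) (auto simp: compactin_euclidean_iff)
  moreover have "closed {x :: nat \<Rightarrow> complex. sqnorm I x = 1 \<and> (\<forall>i<m. (\<Sum>j\<in>I. x j * d i j) = 0)}"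
    unfolding sqnorm_def
    by (intro closed_Collect_conj closed_Collect_all closed_Collect_imp closed_Collect_eq
        continuous_intros continuous_on_product_coordinates open_Collect_const) 
  ultimately have cK: "compact (K \<inter> {x. sqnorm I x = 1 \<and> (\<forall>i<m. (\<Sum>j\<in>I. x j * d i j) = 0)})"
    by (rule compact_Int_closed)
  have "x \<in> K" if "x \<in> vecs_on I" "sqnorm I x = 1" for x
  proof -
    have "cmod (x i) \<le> 1" if "i \<in> I" for i
      using component_le_sqnorm[OF assms that, of x] \<open>sqnorm I x = 1\<close>
      by (simp add: abs_square_le_1)
    then show ?thesis using that(1) by (auto simp: K_def vecs_on_def)
  qed
  moreover have "K \<subseteq> vecs_on I"
    by (auto simp: K_def vecs_on_def PiE_def Pi_def split: if_splits)
  ultimately have "{x \<in> vecs_on I. sqnorm I x = 1 \<and> (\<forall>i<m. (\<Sum>j\<in>I. x j * d i j) = 0)} =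
     K \<inter> {x. sqnorm I x = 1 \<and> (\<forall>i<m. (\<Sum>j\<in>I. x j * d i j) = 0)}"
    by auto
  with cK show ?thesis by simp
qed

lemma continuous_on_qf:
  assumes "hermitian_form Q" "finite I" "S \<subseteq> vecs_on I"
  shows "continuous_on S (qf Q)"
proof -
  have "continuous_on S (\<lambda>x. Re (\<Sum>i\<in>I. \<Sum>j\<in>I. x i * cnj (x j) * Q (unit_vec i) (unit_vec j)))"
    by (intro continuous_intros continuous_on_product_coordinates continuous_on_subset[OF _ subset_UNIV])
  then show ?thesis
    by (rule continuous_on_eq) (use assms in \<open>auto simp: qf_def hermitian_expand[OF assms(1,2)]\<close>)
qed

text \<open>On the compact sphere the weight attains a positive minimum; homogeneity extends the
  bound to all vectors.\<close>

lemma pencil_coercive: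
  assumes "pencil I Q P"
  obtains C where "C > 0" "\<And>x. x \<in> vecs_on I \<Longrightarrow> sqnorm I x \<le> C * qf P x"
proof -
  note p = pencilD[OF assms]
  define S where "S = {x \<in> vecs_on I. sqnorm I x = 1}"
  have cpt: "compact S"
    using compact_sphere[OF p(1), of 0] by (simp add: S_def)
  have scaled: "(\<lambda>n. of_real (1 / sqrt (sqnorm I x)) * x n) \<in> S"
    if "x \<in> vecs_on I" "x \<noteq> 0" for x
    using vecs_on_scale[OF that(1)] sqnorm_normalized[OF p(1) that] unfolding S_def by blast
  show thesis
  proof (cases "S = {}")
    case True
    then have "x = 0" if "x \<in> vecs_on I" for x using scaled that by blast
    then have "sqnorm I x \<le> 1 * qf P x" if "x \<in> vecs_on I" for x
      using that[THEN \<open>\<And>x. x \<in> vecs_on I \<Longrightarrow> x = 0\<close>] hermitian_zero[OF p(3)]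
      by (simp add: sqnorm_def qf_def)
    then show thesis by (intro that[of 1]) auto
  next
    case False
    obtain u where u: "u \<in> S" "\<And>x. x \<in> S \<Longrightarrow> qf P u \<le> qf P x"
      using continuous_attains_inf[OF cpt False continuous_on_qf[OF p(3,1)]] by (auto simp: S_def)
    have "u \<noteq> 0" using u(1) by (auto simp: S_def sqnorm_def)
    then have pos: "0 < qf P u" using u(1) p(4) by (auto simp: S_def)
    show thesis
    proof (rule that[of "1 / qf P u"])
      fix x assume x: "x \<in> vecs_on I"
      show "sqnorm I x \<le> 1 / qf P u * qf P x"
      proof (cases "x = 0")
        case True
        then show ?thesis by (simp add: sqnorm_def qf_def hermitian_zero[OF p(3)])
      next
        case False
        have "qf P u \<le> (1 / sqnorm I x) * qf P x"
          using u(2)[OF scaled[OF x False]] sqnorm_pos[OF p(1) x False]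
          by (simp only: qf_scale[OF p(3)]) (simp add: norm_divide power_divide)
        then show ?thesis using pos sqnorm_pos[OF p(1) x False]
          by (simp add: field_simps)
      qed
    qed (use pos in auto)
  qed
qed

section \<open>Simultaneous diagonalization of a pencil\<close>

lemma minimizer_eigenvector:
  assumes "hermitian_form Q" "hermitian_form P"
    and S: "\<And>x y. x \<in> S \<Longrightarrow> y \<in> S \<Longrightarrow> x + y \<in> S" "\<And>c x. x \<in> S \<Longrightarrow> (\<lambda>n. c * x n) \<in> S"
    and u: "u \<in> S" "qf Q u = \<mu> * qf P u"
    and min: "\<And>x. x \<in> S \<Longrightarrow> \<mu> * qf P x \<le> qf Q x"
    and x: "x \<in> S"
  shows "Q x u = of_real \<mu> * P x u"
proof -
  define H where "H = (\<lambda>x y. Q x y + of_real (- \<mu>) * P x y)"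
  have H: "hermitian_form H" unfolding H_def by (rule hermitian_comb) fact+
  have qH: "qf H y = qf Q y - \<mu> * qf P y" for y
    unfolding H_def qf_comb by simp
  \<comment> \<open>The variation is \<open>x + c * u\<close> rather than \<open>u + c * x\<close>:
    since \<open>qf H u = 0\<close>, the value is affine in \<open>c\<close>, and an affine function
    bounded below is constant.\<close>
  have ineq: "0 \<le> qf H x + 2 * Re (cnj c * H x u)" for c
  proof -
    have "0 \<le> qf H (x + (\<lambda>n. c * u n))"
      unfolding qH using min S x u by simp
    also have "\<dots> = qf H x + 2 * Re (cnj c * H x u)"
      unfolding qf_add[OF H] qf_scale[OF H] hermitian_scale_right[OF H] using u(2) by (simp add: qH)
    finally show ?thesis .
  qed
  have "H x u = 0"
  proof (rule ccontr)
    assume nz: "H x u \<noteq> 0"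
    \<comment> \<open>With this \<open>r\<close> the affine expression equals
      \<open>- qf H x - 2\<close>, which is negative.\<close>
    define r where "r = (qf H x + 1) / (cmod (H x u))\<^sup>2"
    have "0 \<le> qf H x + 2 * Re (cnj (of_real (- r) * H x u) * H x u)"
      by (rule ineq)
    also have "Re (cnj (of_real (- r) * H x u) * H x u) = - r * (cmod (H x u))\<^sup>2"
      unfolding cmod_power2 by (simp add: algebra_simps power2_eq_square)
    also have "- r * (cmod (H x u))\<^sup>2 = - (qf H x + 1)"
      using nz by (simp add: r_def)
    finally have "qf H x \<le> -2" by simp
    moreover have "0 \<le> qf H x" using qH min x by simp
    ultimately show False by simp
  qed
  then show ?thesis by (simp add: H_def)
qed

text \<open>The first \<open>m\<close> vectors of a \<open>P\<close>-orthonormal eigenbasis with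
  ascending eigenvalues. The eigenvalue equation is in weak form, tested against all of
  \<open>vecs_on I\<close>. A partial system with \<open>m < card I\<close> is the induction state
  of the construction.\<close>

definition eig_system where
  "eig_system I Q P m e \<mu> \<longleftrightarrow>
     (\<forall>i<m::nat. e i \<in> vecs_on I) \<and>
     (\<forall>i<m. \<forall>j<m. P (e i) (e j) = (if i = j then 1 else 0)) \<and>
     (\<forall>i<m. \<forall>x\<in>vecs_on I. Q x (e i) = of_real (\<mu> i) * P x (e i)) \<and>
     (\<forall>i j. i \<le> j \<longrightarrow> j < m \<longrightarrow> (\<mu> i :: real) \<le> \<mu> j)"

text \<open>The Rayleigh quotient is continuous on the compact sphere of the
  \<open>P\<close>-orthogonal complement, hence attains its minimum there; rescaling gives
  \<open>P\<close>-norm one.\<close>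

lemma orthogonal_minimizer:
  assumes pc: "pencil I Q P" and e: "\<And>i. i < m \<Longrightarrow> e i \<in> vecs_on I" and m: "m < card I"
  obtains u where "u \<in> vecs_on I" "\<And>i. i < m \<Longrightarrow> P u (e i) = 0" "qf P u = 1"
    "\<And>x. x \<in> vecs_on I \<Longrightarrow> (\<And>i. i < m \<Longrightarrow> P x (e i) = 0) \<Longrightarrow> qf Q u * qf P x \<le> qf Q x"
proof -
  note p = pencilD[OF pc]
  define S where "S = {x \<in> vecs_on I. sqnorm I x = 1 \<and> (\<forall>i<m. P x (e i) = 0)}"
  have "S = {x \<in> vecs_on I. sqnorm I x = 1 \<and> (\<forall>i<m. (\<Sum>j\<in>I. x j * P (unit_vec j) (e i)) = 0)}"
    unfolding S_def using hermitian_expand_left[OF p(3,1)] by auto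
  then have cpt: "compact S" using compact_sphere[OF p(1)] by simp
  have scaled: "(\<lambda>n. of_real (1 / sqrt (sqnorm I x)) * x n) \<in> S"
    if "x \<in> vecs_on I" "\<forall>i<m. P x (e i) = 0" "x \<noteq> 0" for x
    using vecs_on_scale[OF that(1)] sqnorm_normalized[OF p(1) that(1,3)] that(2)
    unfolding S_def mem_Collect_eq hermitian_scale[OF p(3)] by (auto simp del: of_real_divide)
  \<comment> \<open>The complement is nonzero: \<open>m\<close> orthogonality conditions on
    \<open>card I > m\<close> coordinates.\<close>
  obtain c where c: "\<exists>j\<in>I. c j \<noteq> 0" "\<forall>i\<in>{..<m}. (\<Sum>j\<in>I. c j * P (unit_vec j) (e i)) = 0"
    using homogeneous_system_solution[of "{..<m}" I "\<lambda>i j. P (unit_vec j) (e i)"] p(1) m by auto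
  define y where "y n = (if n \<in> I then c n else 0)" for n
  have y: "y \<in> vecs_on I" "y \<noteq> 0" using c(1) by (auto simp: y_def vecs_on_def fun_eq_iff)
  have "P y (e i) = (\<Sum>j\<in>I. c j * P (unit_vec j) (e i))" for i
    unfolding hermitian_expand_left[OF p(3,1) y(1)] by (simp add: y_def)
  then have "S \<noteq> {}" using scaled[OF y(1) _ y(2)] c(2) by auto
  have SV: "S \<subseteq> vecs_on I" by (auto simp: S_def)
  have nz: "x \<noteq> 0" if "x \<in> S" for x using that by (auto simp: S_def sqnorm_def)
  have Ppos: "0 < qf P x" if "x \<in> S" for x using p(4) nz that SV by blast
  have "continuous_on S (\<lambda>x. qf Q x / qf P x)"
    using Ppos by (intro continuous_on_divide continuous_on_qf[OF _ p(1) SV] p) force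
  then obtain v where v: "v \<in> S" "\<And>x. x \<in> S \<Longrightarrow> qf Q v / qf P v \<le> qf Q x / qf P x"
    using continuous_attains_inf[OF cpt \<open>S \<noteq> {}\<close>] by blast
  have ratio: "qf Q v / qf P v * qf P x \<le> qf Q x"
    if "x \<in> vecs_on I" "\<And>i. i < m \<Longrightarrow> P x (e i) = 0" for x
  proof (cases "x = 0")
    case True
    then show ?thesis by (simp add: qf_def hermitian_zero[OF p(3)] hermitian_zero[OF p(2)])
  next
    case False
    have *: "qf Q v / qf P v \<le> qf Q x / qf P x"
      using v(2)[OF scaled[OF that(1) _ False]] that(2) sqnorm_pos[OF p(1) that(1) False]
      unfolding qf_scale[OF p(3)] qf_scale[OF p(2)] by (simp add: norm_divide power_divide)
    show ?thesis
      using mult_right_mono[OF *, of "qf P x"] p(4)[OF that(1) False] by simp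
  qed
  define r where "r = 1 / sqrt (qf P v)"
  define u where "u n = of_real r * v n" for n
  have r2: "(cmod (of_real r))\<^sup>2 = 1 / qf P v" using Ppos[OF v(1)] by (simp add: r_def norm_divide power_divide)
  have qu: "qf Q u = qf Q v / qf P v" "qf P u = 1"
    using Ppos[OF v(1)] r2 by (simp_all add: u_def[abs_def] qf_scale[OF p(3)] qf_scale[OF p(2)] del: norm_of_real)
  show thesis
    by (rule that[of u])
      (use v(1) ratio qu in \<open>auto simp: u_def[abs_def] S_def vecs_on_scale hermitian_scale[OF p(3)]\<close>)
qed

text \<open>Each new vector minimizes the Rayleigh quotient on the complement of the previous ones.
  The minimality is part of the induction claim because it yields the ordering: the new vector also
  competes in all earlier minimizations.\<close>

lemma eig_system_exists_aux:
  assumes pc: "pencil I Q P" and "m \<le> card I"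
  shows "\<exists>e \<mu>. eig_system I Q P m e \<mu> \<and>
     (\<forall>j<m. \<forall>x\<in>vecs_on I. (\<forall>i<j. P x (e i) = 0) \<longrightarrow> \<mu> j * qf P x \<le> qf Q x)"
  using assms(2)
proof (induction m)
  case 0
  then show ?case by (auto simp: eig_system_def)
next
  case (Suc m)
  note p = pencilD[OF pc]
  obtain e \<mu> where es: "eig_system I Q P m e \<mu>" and
    min: "\<And>j x. j < m \<Longrightarrow> x \<in> vecs_on I \<Longrightarrow> (\<And>i. i < j \<Longrightarrow> P x (e i) = 0) \<Longrightarrow> \<mu> j * qf P x \<le> qf Q x"
    using Suc by auto
  have e: "e i \<in> vecs_on I" if "i < m" for i using es that by (auto simp: eig_system_def)
  obtain u where u: "u \<in> vecs_on I" "\<And>i. i < m \<Longrightarrow> P u (e i) = 0" "qf P u = 1"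
    "\<And>x. x \<in> vecs_on I \<Longrightarrow> (\<And>i. i < m \<Longrightarrow> P x (e i) = 0) \<Longrightarrow> qf Q u * qf P x \<le> qf Q x"
    using orthogonal_minimizer[OF pc, of m e] e Suc.prems by (metis Suc_le_lessD)
  define S where "S = {x \<in> vecs_on I. \<forall>i<m. P x (e i) = 0}"
  have eqS: "Q x u = of_real (qf Q u) * P x u" if "x \<in> S" for x
    by (rule minimizer_eigenvector[OF p(2,3), of S])
      (use u that in \<open>auto simp: S_def vecs_on_add vecs_on_scale hermitian_add[OF p(3)] hermitian_scale[OF p(3)]\<close>)
  have ue: "P (e i) u = 0" if "i < m" for i
    using u(2)[OF that] hermitian_cnj[OF p(3), of "e i" u] by simp
  have Que: "Q (e i) u = 0" if "i < m" for i
  proof -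
    have "Q u (e i) = 0" using es that u by (simp add: eig_system_def)
    then show ?thesis using hermitian_cnj[OF p(2), of "e i" u] by simp
  qed
  have equ: "Q x u = of_real (qf Q u) * P x u" if x: "x \<in> vecs_on I" for x
  proof -
    \<comment> \<open>The minimizer is so far an eigenvector only against the complement. A general
      \<open>x\<close> is split into its projection \<open>y\<close> on the earlier eigenvectors,
      where both forms with \<open>u\<close> vanish, and a rest \<open>z\<close> in the
      complement.\<close>
    define y where "y = (\<lambda>n. \<Sum>i<m. P x (e i) * e i n)"
    define z where "z = x + (\<lambda>n. -1 * y n)"
    have y: "y \<in> vecs_on I" unfolding y_def by (rule vecs_on_sum) (use e in auto)
    have "P y (e i) = P x (e i)" if "i < m" for i
    proof -
      have "P y (e i) = (\<Sum>j<m. P x (e j) * (if j = i then 1 else 0))"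
        unfolding y_def hermitian_sum[OF p(3) finite_lessThan]
        using es that by (intro sum.cong) (auto simp: eig_system_def)
      then show ?thesis using that by (simp add: if_distrib cong: if_cong)
    qed
    then have "z \<in> S"
      unfolding S_def z_def mem_Collect_eq hermitian_add[OF p(3)] hermitian_scale[OF p(3)]
      using vecs_on_add[OF x vecs_on_scale[OF y, of "-1"]] by simp
    then have 1: "Q z u = of_real (qf Q u) * P z u" by (rule eqS)
    have 2: "Q y u = 0" "P y u = 0"
      by (simp_all add: y_def hermitian_sum[OF p(3)] hermitian_sum[OF p(2)] ue Que)
    have "Q z u = Q x u - Q y u" "P z u = P x u - P y u"
      unfolding z_def hermitian_add[OF p(3)] hermitian_scale[OF p(3)] hermitian_add[OF p(2)]
        hermitian_scale[OF p(2)] by simp_all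
    with 1 2 show ?thesis by simp
  qed
  define e' where "e' = e(m := u)"
  define \<mu>' where "\<mu>' = \<mu>(m := qf Q u)"
  have mono_u: "\<mu> i \<le> qf Q u" if "i < m" for i
    using min[of i u] u that by auto
  have "eig_system I Q P (Suc m) e' \<mu>'"
    unfolding eig_system_def
  proof (intro conjI allI impI ballI)
    fix i assume "i < Suc m"
    then show "e' i \<in> vecs_on I" using e u by (auto simp: e'_def)
  next
    fix i j assume "i < Suc m" "j < Suc m"
    then show "P (e' i) (e' j) = (if i = j then 1 else 0)"
      using es u ue hermitian_self[OF p(3), of u] by (auto simp: e'_def eig_system_def)
  next
    fix i x assume "i < Suc m" "x \<in> vecs_on I"
    then show "Q x (e' i) = of_real (\<mu>' i) * P x (e' i)"
      using es equ by (auto simp: e'_def \<mu>'_def eig_system_def)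
  next
    fix i j assume "i \<le> j" "j < Suc m"
    then show "\<mu>' i \<le> \<mu>' j"
      using es mono_u by (auto simp: \<mu>'_def eig_system_def)
  qed
  moreover have "\<mu>' j * qf P x \<le> qf Q x" if "j < Suc m" "x \<in> vecs_on I" "\<forall>i<j. P x (e' i) = 0" for j x
  proof (cases "j = m")
    case True
    then show ?thesis using u(4)[of x] that by (auto simp: \<mu>'_def e'_def)
  next
    case False
    then show ?thesis using min[of j x] that by (auto simp: \<mu>'_def e'_def)
  qed
  ultimately show ?case by blast
qed

abbreviation "full_eig_system I Q P \<equiv> eig_system I Q P (card I)"

lemma eig_system_exists: "pencil I Q P \<Longrightarrow> \<exists>\<mu> e. full_eig_system I Q P e \<mu>"
  using eig_system_exists_aux[of I Q P "card I"] by blast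

text \<open>The choice is harmless for indices below \<open>card I\<close>, where all full systems
  have the same eigenvalues; larger indices carry arbitrary values.\<close>

definition pencil_eigval where
  "pencil_eigval I Q P = (SOME \<mu>. \<exists>e. full_eig_system I Q P e \<mu>)"

lemma pencil_eigval:
  assumes "pencil I Q P"
  obtains e where "full_eig_system I Q P e (pencil_eigval I Q P)"
  using someI_ex[OF eig_system_exists[OF assms]] unfolding pencil_eigval_def by blast

lemma eig_systemD:
  assumes "eig_system I Q P m e \<mu>"
  shows "\<And>i. i < m \<Longrightarrow> e i \<in> vecs_on I"
    "\<And>i j. i < m \<Longrightarrow> j < m \<Longrightarrow> P (e i) (e j) = (if i = j then 1 else 0)"
    "\<And>i x. i < m \<Longrightarrow> x \<in> vecs_on I \<Longrightarrow> Q x (e i) = of_real (\<mu> i) * P x (e i)"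
    "\<And>i j. i \<le> j \<Longrightarrow> j < m \<Longrightarrow> \<mu> i \<le> \<mu> j"
  using assms unfolding eig_system_def by simp_all

lemma eig_system_coeff:
  assumes "pencil I Q P" "eig_system I Q P m e \<mu>" "J \<subseteq> {..<m}" "i < m"
  shows "P (\<lambda>n. \<Sum>j\<in>J. c j * e j n) (e i) = (if i \<in> J then c i else 0)"
proof -
  have "finite J" using assms(3) by (rule finite_subset[OF _ finite_lessThan])
  then have "P (\<lambda>n. \<Sum>j\<in>J. c j * e j n) (e i) = (\<Sum>j\<in>J. c j * P (e j) (e i))"
    by (rule hermitian_sum[OF pencilD(3)[OF assms(1)]])
  also have "\<dots> = (\<Sum>j\<in>J. if i = j then c j else 0)"
    using eig_systemD(2)[OF assms(2)] assms(3,4) by (intro sum.cong) auto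
  also have "\<dots> = (if i \<in> J then c i else 0)"
    using \<open>finite J\<close> by simp
  finally show ?thesis .
qed

text \<open>A nonzero \<open>x\<close> orthogonal to the system would make \<open>card I + 1\<close>
  vectors in a space with \<open>card I\<close> coordinates. Pairing their linear relation with each
  \<open>e i\<close> kills its coefficients one by one.\<close>

lemma eig_system_complete:
  assumes pc: "pencil I Q P" and es: "full_eig_system I Q P e \<mu>"
    and x: "x \<in> vecs_on I" and orth: "\<And>i. i < card I \<Longrightarrow> P x (e i) = 0"
  shows "x = 0"
proof (rule ccontr)
  assume "x \<noteq> 0"
  note p = pencilD[OF pc]
  let ?k = "card I"
  define g where "g = e(?k := x)"
  have g: "g j \<in> vecs_on I" if "j \<le> ?k" for j
    using that x eig_systemD(1)[OF es] by (auto simp: g_def)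
  obtain c where c: "\<exists>j\<in>{..?k}. c j \<noteq> 0" "\<forall>i\<in>I. (\<Sum>j\<le>?k. c j * g j i) = 0"
    using homogeneous_system_solution[of I "{..?k}" "\<lambda>i j. g j i"] p(1) by auto
  have zero: "(\<lambda>n. \<Sum>j\<le>?k. c j * g j n) = 0"
  proof
    fix n show "(\<Sum>j\<le>?k. c j * g j n) = 0 n"
      using c(2) g by (cases "n \<in> I") (auto simp: vecs_on_def)
  qed
  have split: "(\<lambda>n. \<Sum>j\<le>?k. c j * g j n) = (\<lambda>n. \<Sum>j\<in>{..<?k}. c j * e j n) + (\<lambda>n. c ?k * x n)"
    by (auto simp: fun_eq_iff g_def lessThan_Suc_atMost[symmetric])
  have "c i = 0" if "i < ?k" for i
  proof -
    have "0 = P (\<lambda>n. \<Sum>j\<le>?k. c j * g j n) (e i)"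
      unfolding zero by (simp add: hermitian_zero[OF p(3)])
    also have "\<dots> = c i"
      unfolding split hermitian_add[OF p(3)] eig_system_coeff[OF pc es order_refl that]
        hermitian_scale[OF p(3)] using orth that by simp
    finally show ?thesis by simp
  qed
  moreover from this have "(\<lambda>n. c ?k * x n) = 0"
    using zero unfolding split by (simp add: fun_eq_iff)
  then have "c ?k = 0" using \<open>x \<noteq> 0\<close> by (auto simp: fun_eq_iff)
  ultimately show False using c(1) by (auto simp: le_less)
qed

lemma eig_system_expand:
  assumes pc: "pencil I Q P" and es: "full_eig_system I Q P e \<mu>" and x: "x \<in> vecs_on I"
  shows "x = (\<lambda>n. \<Sum>i<card I. P x (e i) * e i n)"
proof -
  note p = pencilD[OF pc]
  define y where "y = (\<lambda>n. \<Sum>i<card I. P x (e i) * e i n)"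
  have y: "y \<in> vecs_on I" unfolding y_def by (rule vecs_on_sum) (use eig_systemD(1)[OF es] in auto)
  have "x + (\<lambda>n. -1 * y n) = 0"
  proof (rule eig_system_complete[OF pc es])
    show "x + (\<lambda>n. -1 * y n) \<in> vecs_on I" by (intro vecs_on_add vecs_on_scale x y)
    fix i assume "i < card I"
    then show "P (x + (\<lambda>n. -1 * y n)) (e i) = 0"
      unfolding hermitian_add[OF p(3)] hermitian_scale[OF p(3)] y_def
      by (subst eig_system_coeff[OF pc es]) auto
  qed
  then show ?thesis by (auto simp: fun_eq_iff y_def)
qed

text \<open>Parseval: in the eigenbasis both forms are diagonal, with entries \<open>1\<close> and
  \<open>\<mu> j\<close>.\<close>

lemma eig_system_qf:
  assumes pc: "pencil I Q P" and es: "eig_system I Q P m e \<mu>" and J: "J \<subseteq> {..<m}"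
  shows "qf P (\<lambda>n. \<Sum>j\<in>J. c j * e j n) = (\<Sum>j\<in>J. (cmod (c j))\<^sup>2)" (is "qf P ?x = _")
    and "qf Q (\<lambda>n. \<Sum>j\<in>J. c j * e j n) = (\<Sum>j\<in>J. \<mu> j * (cmod (c j))\<^sup>2)"
proof -
  note p = pencilD[OF pc]
  have fin: "finite J" using J by (rule finite_subset[OF _ finite_lessThan])
  have x: "?x \<in> vecs_on I" by (rule vecs_on_sum) (use J eig_systemD(1)[OF es] in auto)
  have Px: "P ?x (e j) = c j" if "j \<in> J" for j
    by (subst eig_system_coeff[OF pc es J]) (use that J in auto)
  have Qx: "Q ?x (e j) = of_real (\<mu> j) * c j" if "j \<in> J" for j
    using eig_systemD(3)[OF es _ x, of j] Px[OF that] that J by auto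
  have n2: "cnj c * c = of_real ((cmod c)\<^sup>2)" "cnj c * (of_real r * c) = of_real (r * (cmod c)\<^sup>2)" for c r
    using complex_norm_square[of c] by (simp_all add: mult_ac)
  have "P ?x ?x = (\<Sum>j\<in>J. of_real ((cmod (c j))\<^sup>2))"
    by (subst hermitian_sum_right[OF p(3) fin], rule sum.cong) (simp_all only: Px n2)
  then show "qf P ?x = (\<Sum>j\<in>J. (cmod (c j))\<^sup>2)" by (simp add: qf_def)
  have "Q ?x ?x = (\<Sum>j\<in>J. of_real (\<mu> j * (cmod (c j))\<^sup>2))"
    by (subst hermitian_sum_right[OF p(2) fin], rule sum.cong) (simp_all only: Qx n2)
  then show "qf Q ?x = (\<Sum>j\<in>J. \<mu> j * (cmod (c j))\<^sup>2)" by (simp add: qf_def)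
qed

lemma eig_system_lower:
  assumes pc: "pencil I Q P" and es: "full_eig_system I Q P e \<mu>" and x: "x \<in> vecs_on I"
    and m: "m < card I" and orth: "\<And>i. i < m \<Longrightarrow> P x (e i) = 0"
  shows "\<mu> m * qf P x \<le> qf Q x"
proof -
  have "qf P x = (\<Sum>i<card I. (cmod (P x (e i)))\<^sup>2)" "qf Q x = (\<Sum>i<card I. \<mu> i * (cmod (P x (e i)))\<^sup>2)"
    using eig_system_qf[OF pc es order_refl, of "\<lambda>i. P x (e i)"] eig_system_expand[OF pc es x, symmetric]
    by simp_all
  moreover have "\<mu> m * (cmod (P x (e i)))\<^sup>2 \<le> \<mu> i * (cmod (P x (e i)))\<^sup>2" if "i < card I" for i
  proof (cases "i < m")
    case False
    then show ?thesis using eig_systemD(4)[OF es, of m i] that by (simp add: mult_right_mono)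
  qed (simp add: orth)
  ultimately show ?thesis by (auto simp: sum_distrib_left intro!: sum_mono)
qed

lemma eig_system_upper:
  assumes pc: "pencil I Q P" and es: "full_eig_system I Q P e \<mu>" and m: "m < card I"
  shows "qf Q (\<lambda>n. \<Sum>j\<le>m. c j * e j n) \<le> \<mu> m * qf P (\<lambda>n. \<Sum>j\<le>m. c j * e j n)"
proof -
  have J: "{..m} \<subseteq> {..<card I}" using m by auto
  show ?thesis
    unfolding eig_system_qf[OF pc es J] sum_distrib_left
    by (intro sum_mono mult_right_mono eig_systemD(4)[OF es]) (use m in auto)
qed

lemma eig_system_sum_nonzero:
  assumes pc: "pencil I Q P" and es: "full_eig_system I Q P e \<mu>" and m: "m < card I"
    and c: "\<exists>j\<le>m. c j \<noteq> 0"
  shows "(\<lambda>n. \<Sum>j\<le>m. c j * e j n) \<noteq> 0"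
proof
  assume 0: "(\<lambda>n. \<Sum>j\<le>m. c j * e j n) = 0"
  obtain j where j: "j \<le> m" "c j \<noteq> 0" using c by blast
  have "P (\<lambda>n. \<Sum>j\<le>m. c j * e j n) (e j) = c j"
    by (subst eig_system_coeff[OF pc es]) (use j m in auto)
  then show False unfolding 0 using hermitian_zero(1)[OF pencilD(3)[OF pc]] j(2) by simp
qed

text \<open>The two halves of the Courant--Fischer principle.\<close>

lemma eig_system_le:
  assumes pc: "pencil I Q P" and es: "full_eig_system I Q P e \<mu>" and m: "m < card I"
    and u: "\<And>j. j \<le> m \<Longrightarrow> u j \<in> vecs_on I"
    and le: "\<And>c. \<exists>j\<le>m. c j \<noteq> 0 \<Longrightarrow> (\<lambda>n. \<Sum>j\<le>m. c j * u j n) \<noteq> 0 \<and>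
       qf Q (\<lambda>n. \<Sum>j\<le>m. c j * u j n) \<le> t * qf P (\<lambda>n. \<Sum>j\<le>m. c j * u j n)"
  shows "\<mu> m \<le> t"
proof -
  note p = pencilD[OF pc]
  \<comment> \<open>Some nontrivial combination of the \<open>m + 1\<close> test vectors is
    \<open>P\<close>-orthogonal to the first \<open>m\<close> eigenvectors, where the Rayleigh
    quotient is at least \<open>\<mu> m\<close>.\<close>
  obtain c where c: "\<exists>j\<in>{..m}. c j \<noteq> 0" "\<forall>i\<in>{..<m}. (\<Sum>j\<le>m. c j * P (u j) (e i)) = 0"
    using homogeneous_system_solution[of "{..<m}" "{..m}" "\<lambda>i j. P (u j) (e i)"] by auto
  define x where "x = (\<lambda>n. \<Sum>j\<le>m. c j * u j n)"
  have x: "x \<in> vecs_on I" unfolding x_def by (rule vecs_on_sum) (use u in auto)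
  have "P x (e i) = 0" if "i < m" for i
    using c(2) that unfolding x_def hermitian_sum[OF p(3) finite_atMost] by simp
  then have "\<mu> m * qf P x \<le> qf Q x" using eig_system_lower[OF pc es x m] by blast
  also have "\<dots> \<le> t * qf P x" using le[of c] c(1) unfolding x_def by auto
  finally have "\<mu> m * qf P x \<le> t * qf P x" .
  moreover have "0 < qf P x" using p(4)[OF x] le[of c] c(1) unfolding x_def by auto
  ultimately show ?thesis by simp
qed

lemma eig_system_ge:
  assumes pc: "pencil I Q P" and es: "full_eig_system I Q P e \<mu>" and m: "m < card I"
    and lin: "\<And>k c g. k < m \<Longrightarrow> \<phi> k (\<lambda>n. \<Sum>j\<le>m. c j * g j n) = (\<Sum>j\<le>m. c j * \<phi> k (g j) :: complex)"
    and ge: "\<And>x. x \<in> vecs_on I \<Longrightarrow> (\<And>k. k < m \<Longrightarrow> \<phi> k x = 0) \<Longrightarrow> t * qf P x \<le> qf Q x"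
  shows "t \<le> \<mu> m"
proof -
  note p = pencilD[OF pc]
  obtain c where c: "\<exists>j\<in>{..m}. c j \<noteq> 0" "\<forall>i\<in>{..<m}. (\<Sum>j\<le>m. c j * \<phi> i (e j)) = 0"
    using homogeneous_system_solution[of "{..<m}" "{..m}" "\<lambda>i j. \<phi> i (e j)"] by auto
  define x where "x = (\<lambda>n. \<Sum>j\<le>m. c j * e j n)"
  have x: "x \<in> vecs_on I" unfolding x_def by (rule vecs_on_sum) (use eig_systemD(1)[OF es] m in auto)
  have "\<phi> k x = 0" if "k < m" for k
    using c(2) that lin[OF that, of c e] unfolding x_def by simp
  then have "t * qf P x \<le> qf Q x" using ge[OF x] by blast
  also have "\<dots> \<le> \<mu> m * qf P x" using eig_system_upper[OF pc es m] unfolding x_def .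
  finally have "t * qf P x \<le> \<mu> m * qf P x" .
  moreover have "x \<noteq> 0"
    unfolding x_def using c(1) by (intro eig_system_sum_nonzero[OF pc es m]) auto
  then have "0 < qf P x" using p(4)[OF x] by blast
  ultimately show ?thesis by simp
qed

text \<open>The first \<open>m + 1\<close> eigenvectors of the smaller pencil serve as test vectors
  for the larger one. Monotonicity, the bound by the restricted problem and semicontinuity are all
  instances. The comparison is asked only of vectors whose Rayleigh quotient does not exceed the
  eigenvalue in question.\<close>

lemma pencil_eigval_le:
  assumes pc: "pencil I Q P" and pc': "pencil I' Q' P'" and sub: "I \<subseteq> I'" and m: "m < card I"
    and le: "\<And>x. x \<in> vecs_on I \<Longrightarrow> x \<noteq> 0 \<Longrightarrow> qf Q x \<le> pencil_eigval I Q P m * qf P x \<Longrightarrow> qf Q' x \<le> t * qf P' x"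
  shows "pencil_eigval I' Q' P' m \<le> t"
proof -
  obtain e where es: "full_eig_system I Q P e (pencil_eigval I Q P)" using pencil_eigval[OF pc] .
  obtain e' where es': "full_eig_system I' Q' P' e' (pencil_eigval I' Q' P')" using pencil_eigval[OF pc'] .
  have m': "m < card I'" using m card_mono[OF pencilD(1)[OF pc'] sub] by simp
  have e: "e j \<in> vecs_on I" if "j \<le> m" for j using eig_systemD(1)[OF es] that m by auto
  show ?thesis
  proof (rule eig_system_le[OF pc' es' m', of e])
    show "e j \<in> vecs_on I'" if "j \<le> m" for j by (rule subsetD[OF vecs_on_mono[OF sub] e[OF that]])
    fix c :: "nat \<Rightarrow> complex" assume "\<exists>j\<le>m. c j \<noteq> 0"
    then have "(\<lambda>n. \<Sum>j\<le>m. c j * e j n) \<noteq> 0"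
      by (rule eig_system_sum_nonzero[OF pc es m])
    moreover have "(\<lambda>n. \<Sum>j\<le>m. c j * e j n) \<in> vecs_on I" by (rule vecs_on_sum) (use e in auto)
    moreover note eig_system_upper[OF pc es m, of c]
    ultimately show "(\<lambda>n. \<Sum>j\<le>m. c j * e j n) \<noteq> 0 \<and>
       qf Q' (\<lambda>n. \<Sum>j\<le>m. c j * e j n) \<le> t * qf P' (\<lambda>n. \<Sum>j\<le>m. c j * e j n)"
      using le[of "\<lambda>n. \<Sum>j\<le>m. c j * e j n"] by simp
  qed
qed

text \<open>Either system provides test vectors for the other, so the eigenvalues bound each
  other.\<close>

lemma eig_system_unique:
  assumes pc: "pencil I Q P" and es: "full_eig_system I Q P e \<mu>" and m: "m < card I"
  shows "pencil_eigval I Q P m = \<mu> m"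
proof -
  have *: "\<mu>1 m \<le> \<mu>2 m" if es1: "full_eig_system I Q P e1 \<mu>1" and es2: "full_eig_system I Q P e2 \<mu>2"
    for e1 e2 \<mu>1 \<mu>2
  proof (rule eig_system_le[OF pc es1 m, of e2])
    show "e2 j \<in> vecs_on I" if "j \<le> m" for j using eig_systemD(1)[OF es2] that m by auto
    fix c :: "nat \<Rightarrow> complex" assume "\<exists>j\<le>m. c j \<noteq> 0"
    then show "(\<lambda>n. \<Sum>j\<le>m. c j * e2 j n) \<noteq> 0 \<and>
       qf Q (\<lambda>n. \<Sum>j\<le>m. c j * e2 j n) \<le> \<mu>2 m * qf P (\<lambda>n. \<Sum>j\<le>m. c j * e2 j n)"
      using eig_system_sum_nonzero[OF pc es2 m, of c] eig_system_upper[OF pc es2 m, of c] by simp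
  qed
  obtain e' where "full_eig_system I Q P e' (pencil_eigval I Q P)" using pencil_eigval[OF pc] .
  with es show ?thesis by (intro order_antisym) (rule *, assumption, assumption)+
qed

text \<open>The negated eigenvalues in reverse order form a system for \<open>- Q\<close>. This
  turns upper into lower bounds and \<open>s\<close> tending to infinity into \<open>s\<close>
  tending to minus infinity.\<close>

lemma pencil_eigval_uminus:
  assumes pc: "pencil I Q P" and m: "m < card I"
  shows "pencil_eigval I (\<lambda>x y. - Q x y) P m = - pencil_eigval I Q P (card I - 1 - m)"
proof -
  let ?k = "card I"
  obtain e where es: "full_eig_system I Q P e (pencil_eigval I Q P)" using pencil_eigval[OF pc] .
  have "full_eig_system I (\<lambda>x y. - Q x y) P (\<lambda>i. e (?k - 1 - i)) (\<lambda>i. - pencil_eigval I Q P (?k - 1 - i))"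
    unfolding eig_system_def
  proof (intro conjI allI impI ballI)
    fix i j assume "i < ?k" "j < ?k"
    moreover from this have "?k - 1 - i = ?k - 1 - j \<longleftrightarrow> i = j" by auto
    ultimately show "P (e (?k - 1 - i)) (e (?k - 1 - j)) = (if i = j then 1 else 0)"
      using eig_systemD(2)[OF es, of "?k - 1 - i" "?k - 1 - j"] by simp
  next
    fix i j :: nat assume "i \<le> j" "j < ?k"
    then show "- pencil_eigval I Q P (?k - 1 - i) \<le> - pencil_eigval I Q P (?k - 1 - j)"
      using eig_systemD(4)[OF es, of "?k - 1 - j" "?k - 1 - i"] by simp
  qed (use eig_systemD(1,3)[OF es] in auto)
  from eig_system_unique[OF pencil_uminus[OF pc] this m] show ?thesis .
qed

lemma pencil_eigval_0_le:
  assumes pc: "pencil I Q P" and x: "x \<in> vecs_on I" "x \<noteq> 0"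
  shows "pencil_eigval I Q P 0 \<le> qf Q x / qf P x"
proof -
  obtain e where es: "full_eig_system I Q P e (pencil_eigval I Q P)" using pencil_eigval[OF pc] .
  have "0 < card I" using x pencilD(1)[OF pc] by (auto simp: card_gt_0_iff vecs_on_def fun_eq_iff)
  then show ?thesis
    using eig_system_lower[OF pc es x(1), of 0] pencilD(4)[OF pc x] by (simp add: field_simps)
qed

lemma pencil_eigval_last_ge:
  assumes pc: "pencil I Q P" and x: "x \<in> vecs_on I" "x \<noteq> 0"
  shows "qf Q x / qf P x \<le> pencil_eigval I Q P (card I - 1)"
proof -
  have "0 < card I" using x pencilD(1)[OF pc] by (auto simp: card_gt_0_iff vecs_on_def fun_eq_iff)
  then have "pencil_eigval I (\<lambda>x y. - Q x y) P 0 = - pencil_eigval I Q P (card I - 1)"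
    using pencil_eigval_uminus[OF pc, of 0] by simp
  then show ?thesis
    using pencil_eigval_0_le[OF pencil_uminus[OF pc] x] by (simp add: qf_uminus)
qed

section \<open>Continuity of the eigenvalues under entrywise convergence\<close>

lemma qf_diff_le:
  assumes "hermitian_form Q" "hermitian_form Q'" "finite I" "x \<in> vecs_on I"
  shows "\<bar>qf Q x - qf Q' x\<bar> \<le>
    (\<Sum>i\<in>I. \<Sum>j\<in>I. cmod (Q (unit_vec i) (unit_vec j) - Q' (unit_vec i) (unit_vec j))) * sqnorm I x"
  using qf_le_sqnorm[OF hermitian_comb[OF assms(1,2), of "- 1"] assms(3,4)]
  unfolding qf_comb by simp

lemma eventually_qf_close:
  assumes "finite I" "hermitian_form Q'" "\<And>t. hermitian_form (Q t)"
    and lim: "\<And>i j. i \<in> I \<Longrightarrow> j \<in> I \<Longrightarrow>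
      ((\<lambda>t. Q t (unit_vec i) (unit_vec j)) \<longlongrightarrow> Q' (unit_vec i) (unit_vec j)) F"
    and "0 < \<delta>"
  shows "\<forall>\<^sub>F t in F. \<forall>x\<in>vecs_on I. \<bar>qf (Q t) x - qf Q' x\<bar> \<le> \<delta> * sqnorm I x"
proof -
  let ?d = "\<lambda>t. \<Sum>i\<in>I. \<Sum>j\<in>I. cmod (Q t (unit_vec i) (unit_vec j) - Q' (unit_vec i) (unit_vec j))"
  have "(?d \<longlongrightarrow> 0) F"
    by (intro tendsto_null_sum tendsto_norm_zero LIM_zero lim)
  then have "\<forall>\<^sub>F t in F. ?d t < \<delta>" using \<open>0 < \<delta>\<close> order_tendstoD(2) by blast
  then show ?thesis
  proof eventually_elim
    case (elim t)
    show ?case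
    proof
      fix x assume x: "x \<in> vecs_on I"
      have "\<bar>qf (Q t) x - qf Q' x\<bar> \<le> ?d t * sqnorm I x"
        by (rule qf_diff_le) fact+
      also have "\<dots> \<le> \<delta> * sqnorm I x"
        by (intro mult_right_mono sqnorm_nonneg) (use elim in simp)
      finally show "\<bar>qf (Q t) x - qf Q' x\<bar> \<le> \<delta> * sqnorm I x" .
    qed
  qed
qed

text \<open>Upper semicontinuity. The eigenvectors of the limit pencil are test vectors for the
  nearby ones, and coercivity of the limit weight absorbs the perturbation of both forms.\<close>

lemma eventually_pencil_eigval_le:
  assumes pc: "pencil I Q' P'" and pct: "\<And>t. pencil I (Q t) (P t)" and m: "m < card I"
    and limQ: "\<And>i j. i \<in> I \<Longrightarrow> j \<in> I \<Longrightarrow>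
      ((\<lambda>t. Q t (unit_vec i) (unit_vec j)) \<longlongrightarrow> Q' (unit_vec i) (unit_vec j)) F"
    and limP: "\<And>i j. i \<in> I \<Longrightarrow> j \<in> I \<Longrightarrow>
      ((\<lambda>t. P t (unit_vec i) (unit_vec j)) \<longlongrightarrow> P' (unit_vec i) (unit_vec j)) F"
    and "0 < \<epsilon>"
  shows "\<forall>\<^sub>F t in F. pencil_eigval I (Q t) (P t) m \<le> pencil_eigval I Q' P' m + \<epsilon>"
proof -
  note p = pencilD[OF pc]
  obtain C where C: "C > 0" "\<And>x. x \<in> vecs_on I \<Longrightarrow> sqnorm I x \<le> C * qf P' x"
    using pencil_coercive[OF pc] by blast
  define \<mu> where "\<mu> = pencil_eigval I Q' P' m"
  \<comment> \<open>An error \<open>\<delta>\<close> in \<open>Q\<close> and one in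
    \<open>P\<close>, the latter multiplied by \<open>\<mu> + \<epsilon>\<close>, then add up to at
    most \<open>\<epsilon> * qf P' x\<close>.\<close>
  define \<delta> where "\<delta> = \<epsilon> / (C * (1 + \<bar>\<mu> + \<epsilon>\<bar>))"
  have \<delta>: "\<delta> > 0" "\<delta> * (1 + \<bar>\<mu> + \<epsilon>\<bar>) * C = \<epsilon>"
    using \<open>0 < \<epsilon>\<close> C(1) abs_ge_zero[of "\<mu> + \<epsilon>"] unfolding \<delta>_def
    by (simp_all add: add_pos_nonneg del: abs_ge_zero)
  have "\<forall>\<^sub>F t in F. \<forall>x\<in>vecs_on I. \<bar>qf (Q t) x - qf Q' x\<bar> \<le> \<delta> * sqnorm I x"
    by (rule eventually_qf_close[OF p(1,2) pencilD(2)[OF pct] limQ \<delta>(1)])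
  moreover have "\<forall>\<^sub>F t in F. \<forall>x\<in>vecs_on I. \<bar>qf (P t) x - qf P' x\<bar> \<le> \<delta> * sqnorm I x"
    by (rule eventually_qf_close[OF p(1,3) pencilD(3)[OF pct] limP \<delta>(1)])
  ultimately show ?thesis
  proof eventually_elim
    case (elim t)
    show ?case
    proof (rule pencil_eigval_le[OF pc pct order_refl m], fold \<mu>_def)
      fix x assume x: "x \<in> vecs_on I" and le: "qf Q' x \<le> \<mu> * qf P' x"
      have "qf (Q t) x \<le> \<mu> * qf P' x + \<delta> * sqnorm I x"
        using elim(1) x le by fastforce
      moreover have "(\<mu> + \<epsilon>) * (qf P' x - qf (P t) x) \<le> \<bar>\<mu> + \<epsilon>\<bar> * (\<delta> * sqnorm I x)"
      proof -
        have "\<bar>qf (P t) x - qf P' x\<bar> \<le> \<delta> * sqnorm I x" using elim(2) x by blast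
        then have "\<bar>\<mu> + \<epsilon>\<bar> * \<bar>qf (P t) x - qf P' x\<bar> \<le> \<bar>\<mu> + \<epsilon>\<bar> * (\<delta> * sqnorm I x)"
          by (rule mult_left_mono) simp
        moreover have "(\<mu> + \<epsilon>) * (qf P' x - qf (P t) x) \<le> \<bar>\<mu> + \<epsilon>\<bar> * \<bar>qf (P t) x - qf P' x\<bar>"
          by (metis abs_ge_self abs_minus_commute abs_mult)
        ultimately show ?thesis by linarith
      qed
      moreover have "\<delta> * (1 + \<bar>\<mu> + \<epsilon>\<bar>) * sqnorm I x \<le> \<epsilon> * qf P' x"
      proof -
        have "\<delta> * (1 + \<bar>\<mu> + \<epsilon>\<bar>) * sqnorm I x \<le> \<delta> * (1 + \<bar>\<mu> + \<epsilon>\<bar>) * (C * qf P' x)"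
          by (intro mult_left_mono C x) (use \<delta> in auto)
        then show ?thesis using \<delta>(2) by (simp flip: mult.assoc)
      qed
      ultimately show "qf (Q t) x \<le> (\<mu> + \<epsilon>) * qf (P t) x"
        by (simp add: algebra_simps)
    qed
  qed
qed

lemma tendsto_pencil_eigval:
  assumes pc: "pencil I Q' P'" and pct: "\<And>t. pencil I (Q t) (P t)" and m: "m < card I"
    and limQ: "\<And>i j. i \<in> I \<Longrightarrow> j \<in> I \<Longrightarrow>
      ((\<lambda>t. Q t (unit_vec i) (unit_vec j)) \<longlongrightarrow> Q' (unit_vec i) (unit_vec j)) F"
    and limP: "\<And>i j. i \<in> I \<Longrightarrow> j \<in> I \<Longrightarrow>
      ((\<lambda>t. P t (unit_vec i) (unit_vec j)) \<longlongrightarrow> P' (unit_vec i) (unit_vec j)) F"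
  shows "((\<lambda>t. pencil_eigval I (Q t) (P t) m) \<longlongrightarrow> pencil_eigval I Q' P' m) F"
proof (rule tendstoI)
  fix \<epsilon> :: real assume "0 < \<epsilon>"
  \<comment> \<open>Lower semicontinuity is upper semicontinuity of \<open>- Q\<close> at the
    mirrored index.\<close>
  define m' where "m' = card I - 1 - m"
  have m': "m' < card I" "card I - 1 - m' = m" using m by (auto simp: m'_def)
  have 1: "\<forall>\<^sub>F t in F. pencil_eigval I (Q t) (P t) m \<le> pencil_eigval I Q' P' m + \<epsilon> / 2"
    by (rule eventually_pencil_eigval_le[OF pc pct m limQ limP]) (use \<open>0 < \<epsilon>\<close> in auto)
  have "\<forall>\<^sub>F t in F. pencil_eigval I (\<lambda>x y. - Q t x y) (P t) m'
      \<le> pencil_eigval I (\<lambda>x y. - Q' x y) P' m' + \<epsilon> / 2"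
    by (rule eventually_pencil_eigval_le[where Q = "\<lambda>t x y. - Q t x y",
          OF pencil_uminus[OF pc] pencil_uminus[OF pct] m'(1) tendsto_minus[OF limQ] limP])
      (use \<open>0 < \<epsilon>\<close> in auto)
  then have "\<forall>\<^sub>F t in F. pencil_eigval I Q' P' m - \<epsilon> / 2 \<le> pencil_eigval I (Q t) (P t) m"
    unfolding pencil_eigval_uminus[OF pc m'(1)] pencil_eigval_uminus[OF pct m'(1)] m'(2)
    by eventually_elim simp
  with 1 show "\<forall>\<^sub>F t in F. dist (pencil_eigval I (Q t) (P t) m) (pencil_eigval I Q' P' m) < \<epsilon>"
    by eventually_elim (use \<open>0 < \<epsilon>\<close> in \<open>simp add: dist_real_def\<close>)
qed

section \<open>Large rank-one perturbations\<close>

abbreviation rank_one_pert where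
  "rank_one_pert R p s \<equiv> (\<lambda>x y. R x y + of_real s * (x (p::nat) * cnj (y p)))"

lemma hermitian_coordinate: "hermitian_form (\<lambda>x y. x p * cnj (y p))"
  by (rule hermitian_formI) (auto simp: algebra_simps)

lemma qf_rank_one_pert: "qf (rank_one_pert R p s) x = qf R x + s * (cmod (x p))\<^sup>2"
  unfolding qf_comb by (simp add: qf_def flip: complex_norm_square)

lemma pencil_rank_one_pert: "pencil I R P \<Longrightarrow> pencil I (rank_one_pert R p s) P"
  using hermitian_comb[OF _ hermitian_coordinate] unfolding pencil_def by simp

lemma rank_one_pert_mono:
  assumes "pencil I R P" "s \<le> s'" "m < card I"
  shows "pencil_eigval I (rank_one_pert R p s) P m \<le> pencil_eigval I (rank_one_pert R p s') P m"
  by (rule pencil_eigval_le[OF pencil_rank_one_pert pencil_rank_one_pert order_refl])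
    (use assms in \<open>auto simp: qf_rank_one_pert intro: order_trans[OF add_left_mono[OF mult_right_mono]]\<close>)

text \<open>The penalty vanishes on \<open>vecs_on I\<close> because \<open>p \<notin> I\<close>;
  the bound is therefore the same for all \<open>s\<close>.\<close>

lemma rank_one_pert_le:
  assumes pc: "pencil (insert p I) R P" and p: "p \<notin> I" and m: "m < card I"
  shows "pencil_eigval (insert p I) (rank_one_pert R p s) P m \<le> pencil_eigval I R P m"
proof (rule pencil_eigval_le[OF pencil_subset[OF pc] pencil_rank_one_pert[OF pc] _ m])
  fix x assume "x \<in> vecs_on I" "qf R x \<le> pencil_eigval I R P m * qf P x"
  then show "qf (rank_one_pert R p s) x \<le> pencil_eigval I R P m * qf P x"
    using p by (simp add: qf_rank_one_pert vecs_on_def)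
qed auto

text \<open>Each coordinate of \<open>x\<close> is at most its norm, and the norm is controlled by
  the weight. \<open>F\<close> may be indefinite.\<close>

lemma cross_term_bound:
  assumes pc: "pencil I R P" and F: "hermitian_form F"
  obtains K where "K > 0" "\<And>x. x \<in> vecs_on I \<Longrightarrow> (cmod (F x v))\<^sup>2 \<le> K * qf P x"
proof -
  note p = pencilD[OF pc]
  obtain C where C: "C > 0" "\<And>x. x \<in> vecs_on I \<Longrightarrow> sqnorm I x \<le> C * qf P x"
    using pencil_coercive[OF pc] by blast
  \<comment> \<open>The summand \<open>1\<close> keeps the constant positive even if all entries
    vanish.\<close>
  define a where "a = (\<Sum>i\<in>I. cmod (F (unit_vec i) v)) + 1"
  have a: "a > 0" unfolding a_def by (simp add: add_nonneg_pos sum_nonneg)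
  show thesis
  proof (rule that[of "a\<^sup>2 * C"])
    fix x assume x: "x \<in> vecs_on I"
    have "cmod (F x v) \<le> (\<Sum>i\<in>I. cmod (x i) * cmod (F (unit_vec i) v))"
      unfolding hermitian_expand_left[OF F p(1) x] by (rule sum_norm_le) (simp add: norm_mult)
    also have "\<dots> \<le> (\<Sum>i\<in>I. sqrt (sqnorm I x) * cmod (F (unit_vec i) v))"
      by (intro sum_mono mult_right_mono real_le_rsqrt component_le_sqnorm p(1)) auto
    also have "\<dots> \<le> sqrt (sqnorm I x) * a"
      unfolding a_def sum_distrib_left[symmetric] by (intro mult_left_mono) (auto simp: sqnorm_nonneg)
    finally have "(cmod (F x v))\<^sup>2 \<le> (sqrt (sqnorm I x) * a)\<^sup>2"
      by (rule power_mono) simp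
    also have "\<dots> = a\<^sup>2 * sqnorm I x" by (simp add: power_mult_distrib sqnorm_nonneg)
    also have "\<dots> \<le> a\<^sup>2 * (C * qf P x)" by (intro mult_left_mono C x) simp
    finally show "(cmod (F x v))\<^sup>2 \<le> a\<^sup>2 * C * qf P x" by (simp add: mult.assoc)
  qed (use a C in simp)
qed

text \<open>Split \<open>x\<close> into its part in \<open>vecs_on I\<close> and a multiple of
  \<open>unit_vec p\<close>. Off the first \<open>m\<close> restricted eigenvectors the shifted form
  \<open>F\<close> exceeds \<open>\<epsilon> * P\<close> on the first part; this surplus pays for
  the cross term, and everything quadratic in \<open>x p\<close> is beaten by a large
  \<open>s\<close>.\<close>

lemma rank_one_pert_ge:
  assumes pc: "pencil (insert p I) R P" and p: "p \<notin> I" and m: "m < card I" and "0 < \<epsilon>"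
  shows "\<exists>S. \<forall>s\<ge>S. pencil_eigval I R P m - \<epsilon> \<le> pencil_eigval (insert p I) (rank_one_pert R p s) P m"
proof -
  have pcI: "pencil I R P" by (rule pencil_subset[OF pc]) auto
  note h = pencilD[OF pcI]
  obtain e where es: "full_eig_system I R P e (pencil_eigval I R P)" using pencil_eigval[OF pcI] .
  define \<tau> where "\<tau> = pencil_eigval I R P m"
  define F where "F = (\<lambda>x y. R x y + of_real (- (\<tau> - \<epsilon>)) * P x y)"
  have F: "hermitian_form F" unfolding F_def by (rule hermitian_comb) fact+
  have qF: "qf F x = qf R x - (\<tau> - \<epsilon>) * qf P x" for x
    unfolding F_def qf_comb by (simp add: algebra_simps)
  define v where "v = unit_vec p"
  obtain K where K: "K > 0" "\<And>x. x \<in> vecs_on I \<Longrightarrow> (cmod (F x v))\<^sup>2 \<le> K * qf P x"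
    using cross_term_bound[OF pcI F] by blast
  \<comment> \<open>\<open>K / \<epsilon>\<close> is the price of the cross term,
    \<open>- qf F v\<close> compensates the diagonal term of \<open>x p\<close>.\<close>
  define S where "S = K / \<epsilon> - qf F v"
  have "\<tau> - \<epsilon> \<le> pencil_eigval (insert p I) (rank_one_pert R p s) P m" if s: "S \<le> s" for s
  proof -
    have pcs: "pencil (insert p I) (rank_one_pert R p s) P" by (rule pencil_rank_one_pert[OF pc])
    obtain e' where es': "full_eig_system (insert p I) (rank_one_pert R p s) P e'
        (pencil_eigval (insert p I) (rank_one_pert R p s) P)"
      using pencil_eigval[OF pcs] .
    \<comment> \<open>The constraints see only the part of \<open>x\<close> in
      \<open>vecs_on I\<close>: they are orthogonality to the first \<open>m\<close> restricted
      eigenvectors after erasing coordinate \<open>p\<close>.\<close>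
    show ?thesis
    proof (rule eig_system_ge[OF pcs es', where \<phi> = "\<lambda>k x. P (x(p := 0)) (e k)"])
      show "m < card (insert p I)" using m p h(1) by simp
    next
      fix k and c :: "nat \<Rightarrow> complex" and g :: "nat \<Rightarrow> nat \<Rightarrow> complex"
      have "(\<lambda>n. \<Sum>j\<le>m. c j * g j n)(p := 0) = (\<lambda>n. \<Sum>j\<le>m. c j * ((g j)(p := 0)) n)"
        by (auto simp: fun_eq_iff)
      then show "P ((\<lambda>n. \<Sum>j\<le>m. c j * g j n)(p := 0)) (e k) = (\<Sum>j\<le>m. c j * P ((g j)(p := 0)) (e k))"
        by (simp only: hermitian_sum[OF h(3) finite_atMost])
    next
      fix x assume x: "x \<in> vecs_on (insert p I)" and orth: "\<And>k. k < m \<Longrightarrow> P (x(p := 0)) (e k) = 0"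
      define x' where "x' = x(p := 0)"
      have x': "x' \<in> vecs_on I" using x by (auto simp: x'_def vecs_on_def)
      have split: "x = x' + (\<lambda>n. x p * v n)" by (auto simp: x'_def v_def unit_vec_def fun_eq_iff)
      have "\<tau> * qf P x' \<le> qf R x'"
        unfolding \<tau>_def using eig_system_lower[OF pcI es x' m] orth by (simp add: x'_def)
      then have 1: "\<epsilon> * qf P x' \<le> qf F x'" unfolding qF by (simp add: algebra_simps)
      have eq: "qf F x = qf F x' + 2 * Re (cnj (x p) * F x' v) + (cmod (x p))\<^sup>2 * qf F v"
        by (subst split) (simp add: qf_add[OF F] qf_scale[OF F] hermitian_scale_right[OF F])
      have "2 * \<bar>Re (cnj (x p) * F x' v)\<bar> \<le> 2 * (cmod (x p) * cmod (F x' v))"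
        by (metis abs_Re_le_cmod complex_mod_cnj mult_left_mono norm_mult zero_le_numeral)
      also have "\<dots> \<le> K / \<epsilon> * (cmod (x p))\<^sup>2 + \<epsilon> / K * (cmod (F x' v))\<^sup>2"
      proof -
        \<comment> \<open>Weighted arithmetic-geometric mean inequality; the weights are reciprocal,
          and \<open>\<epsilon> / K\<close> is what turns the bound \<open>K * qf P x'\<close> into
          the available surplus.\<close>
        have "0 \<le> (sqrt (K / \<epsilon>) * cmod (x p) - sqrt (\<epsilon> / K) * cmod (F x' v))\<^sup>2" by simp
        also have "\<dots> = K / \<epsilon> * (cmod (x p))\<^sup>2 + \<epsilon> / K * (cmod (F x' v))\<^sup>2
            - 2 * (sqrt (K / \<epsilon>) * sqrt (\<epsilon> / K)) * (cmod (x p) * cmod (F x' v))"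
          using K(1) \<open>0 < \<epsilon>\<close> by (simp add: power2_diff power_mult_distrib)
        also have "sqrt (K / \<epsilon>) * sqrt (\<epsilon> / K) = 1"
          using K(1) \<open>0 < \<epsilon>\<close> by (simp flip: real_sqrt_mult)
        finally show ?thesis by simp
      qed
      also have "\<epsilon> / K * (cmod (F x' v))\<^sup>2 \<le> \<epsilon> * qf P x'"
        using mult_left_mono[OF K(2)[OF x'], of "\<epsilon> / K"] K(1) \<open>0 < \<epsilon>\<close> by simp
      finally have "- (K / \<epsilon>) * (cmod (x p))\<^sup>2 - \<epsilon> * qf P x' \<le> 2 * Re (cnj (x p) * F x' v)"
        by linarith
      with 1 have "(qf F v - K / \<epsilon>) * (cmod (x p))\<^sup>2 \<le> qf F x"
        unfolding eq by (simp add: algebra_simps)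
      moreover have "0 \<le> (s - S) * (cmod (x p))\<^sup>2" using s by simp
      ultimately have "0 \<le> qf F x + s * (cmod (x p))\<^sup>2"
        unfolding S_def by (simp add: algebra_simps)
      then show "(\<tau> - \<epsilon>) * qf P x \<le> qf (rank_one_pert R p s) x"
        unfolding qF qf_rank_one_pert by simp
    qed
  qed
  then show ?thesis unfolding \<tau>_def by blast
qed

context
  fixes R P :: "'t \<Rightarrow> (nat \<Rightarrow> complex) \<Rightarrow> (nat \<Rightarrow> complex) \<Rightarrow> complex" and R' P' p I and F :: "'t filter"
  assumes pc: "pencil (insert p I) R' P'" and pct: "\<And>t. pencil (insert p I) (R t) (P t)"
    and p: "p \<notin> I"
    and limR: "\<And>i j. i \<in> insert p I \<Longrightarrow> j \<in> insert p I \<Longrightarrow>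
      ((\<lambda>t. R t (unit_vec i) (unit_vec j)) \<longlongrightarrow> R' (unit_vec i) (unit_vec j)) F"
    and limP: "\<And>i j. i \<in> insert p I \<Longrightarrow> j \<in> insert p I \<Longrightarrow>
      ((\<lambda>t. P t (unit_vec i) (unit_vec j)) \<longlongrightarrow> P' (unit_vec i) (unit_vec j)) F"
begin

text \<open>The forms and \<open>s\<close> vary together. The upper bound is the restricted
  eigenvalue of the moving forms; for the lower bound \<open>s t\<close> is replaced by a fixed
  smaller \<open>S\<close>, and continuity in the forms is used at \<open>S\<close>.\<close>

lemma tendsto_rank_one_pert_at_top:
  assumes m: "m < card I" and s: "filterlim s at_top F"
  shows "((\<lambda>t. pencil_eigval (insert p I) (rank_one_pert (R t) p (s t)) (P t) m)
    \<longlongrightarrow> pencil_eigval I R' P' m) F"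
proof (rule tendstoI)
  fix \<epsilon> :: real assume \<epsilon>: "0 < \<epsilon>"
  have pcI: "pencil I R' P'" and pctI: "\<And>t. pencil I (R t) (P t)"
    by (rule pencil_subset[OF pc], auto) (rule pencil_subset[OF pct], auto)
  have m': "m < card (insert p I)" using m p pencilD(1)[OF pcI] by simp
  have 1: "\<forall>\<^sub>F t in F. pencil_eigval I (R t) (P t) m \<le> pencil_eigval I R' P' m + \<epsilon> / 2"
    by (rule eventually_pencil_eigval_le[OF pcI pctI m limR limP]) (use \<epsilon> in auto)
  \<comment> \<open>\<open>S\<close> depends on the limit forms only. One quarter of
    \<open>\<epsilon>\<close> is spent here and one on the convergence at \<open>S\<close>.\<close>
  obtain S where S: "\<And>s. s \<ge> S \<Longrightarrow>
      pencil_eigval I R' P' m - \<epsilon> / 4 \<le> pencil_eigval (insert p I) (rank_one_pert R' p s) P' m"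
    using rank_one_pert_ge[OF pc p m, of "\<epsilon> / 4"] \<epsilon> by auto
  have "((\<lambda>t. pencil_eigval (insert p I) (rank_one_pert (R t) p S) (P t) m)
      \<longlongrightarrow> pencil_eigval (insert p I) (rank_one_pert R' p S) P' m) F"
    by (rule tendsto_pencil_eigval[where Q = "\<lambda>t. rank_one_pert (R t) p S"])
      (intro pencil_rank_one_pert pc pct m' limP tendsto_add tendsto_const limR; assumption)+
  then have 2: "\<forall>\<^sub>F t in F. pencil_eigval (insert p I) (rank_one_pert R' p S) P' m - \<epsilon> / 4
      < pencil_eigval (insert p I) (rank_one_pert (R t) p S) (P t) m"
    using \<epsilon> by (intro order_tendstoD(1)) auto
  have 3: "\<forall>\<^sub>F t in F. S \<le> s t" using s by (simp add: filterlim_at_top)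
  from 1 2 3 show "\<forall>\<^sub>F t in F. dist (pencil_eigval (insert p I) (rank_one_pert (R t) p (s t)) (P t) m)
      (pencil_eigval I R' P' m) < \<epsilon>"
  proof eventually_elim
    case (elim t)
    then show ?case
      using S[of S] rank_one_pert_le[OF pct[of t] p m, of "s t"] \<epsilon>
        rank_one_pert_mono[OF pct[of t] elim(3) m', of p]
      by (simp add: dist_real_def)
  qed
qed

text \<open>The Rayleigh quotient of \<open>unit_vec p\<close> grows linearly in \<open>s\<close>
  and bounds the last eigenvalue from below. The last index is \<open>card I\<close> since
  \<open>insert p I\<close> has one element more.\<close>

lemma rank_one_pert_last_at_top:
  assumes s: "filterlim s at_top F"
  shows "filterlim (\<lambda>t. pencil_eigval (insert p I) (rank_one_pert (R t) p (s t)) (P t) (card I)) at_top F"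
proof -
  let ?v = "unit_vec p"
  have v: "?v \<in> vecs_on (insert p I)" "?v \<noteq> 0"
    by (auto simp: unit_vec_vecs_on unit_vec_def fun_eq_iff)
  have card: "card (insert p I) - 1 = card I" using p pencilD(1)[OF pc] by simp
  have "filterlim (\<lambda>t. (qf (R t) ?v + s t) / qf (P t) ?v) at_top F"
  proof -
    have "((\<lambda>t. qf (R t) ?v) \<longlongrightarrow> qf R' ?v) F" "((\<lambda>t. qf (P t) ?v) \<longlongrightarrow> qf P' ?v) F"
      unfolding qf_def by (auto intro!: tendsto_Re limR limP)
    then have "((\<lambda>t. inverse (qf (P t) ?v)) \<longlongrightarrow> inverse (qf P' ?v)) F"
      "filterlim (\<lambda>t. qf (R t) ?v + s t) at_top F"
      using pencilD(4)[OF pc v] by (auto intro!: tendsto_inverse filterlim_tendsto_add_at_top s)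
    then show ?thesis
      unfolding divide_inverse using pencilD(4)[OF pc v]
      by (subst mult.commute) (rule filterlim_tendsto_pos_mult_at_top[where c = "inverse (qf P' ?v)"], auto)
  qed
  moreover have "(qf (R t) ?v + s t) / qf (P t) ?v
      \<le> pencil_eigval (insert p I) (rank_one_pert (R t) p (s t)) (P t) (card I)" for t
    using pencil_eigval_last_ge[OF pencil_rank_one_pert[OF pct[of t]] v, of "s t" p] card
    by (simp add: qf_rank_one_pert unit_vec_def)
  ultimately show ?thesis
    by (blast intro: filterlim_at_top_mono always_eventually)
qed

end

context
  fixes R P :: "'t \<Rightarrow> (nat \<Rightarrow> complex) \<Rightarrow> (nat \<Rightarrow> complex) \<Rightarrow> complex" and R' P' p I and F :: "'t filter"
  assumes pc: "pencil (insert p I) R' P'" and pct: "\<And>t. pencil (insert p I) (R t) (P t)"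
    and p: "p \<notin> I"
    and limR: "\<And>i j. i \<in> insert p I \<Longrightarrow> j \<in> insert p I \<Longrightarrow>
      ((\<lambda>t. R t (unit_vec i) (unit_vec j)) \<longlongrightarrow> R' (unit_vec i) (unit_vec j)) F"
    and limP: "\<And>i j. i \<in> insert p I \<Longrightarrow> j \<in> insert p I \<Longrightarrow>
      ((\<lambda>t. P t (unit_vec i) (unit_vec j)) \<longlongrightarrow> P' (unit_vec i) (unit_vec j)) F"
begin

lemma rank_one_pert_uminus:
  assumes "m \<le> card I"
  shows "pencil_eigval (insert p I) (rank_one_pert (R t) p s) (P t) m =
    - pencil_eigval (insert p I) (rank_one_pert (\<lambda>x y. - R t x y) p (- s)) (P t) (card I - m)"
proof -
  have card: "card (insert p I) = Suc (card I)" using p pencilD(1)[OF pc] by simp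
  have eq: "rank_one_pert (\<lambda>x y. - R t x y) p (- s) = (\<lambda>x y. - rank_one_pert (R t) p s x y)"
    by (intro ext) simp
  show ?thesis
    unfolding eq using pencil_eigval_uminus[OF pencil_rank_one_pert[OF pct[of t]], of "card I - m" s p] assms
    by (simp add: card)
qed

text \<open>The index shift is a mismatch of two reflections: \<open>m\<close> becomes
  \<open>card I - m\<close> among the \<open>card I + 1\<close> eigenvalues of the perturbed pencil,
  and this goes back to \<open>m - 1\<close> among the \<open>card I\<close> eigenvalues of the
  restricted one.\<close>

lemma tendsto_rank_one_pert_at_bot:
  assumes m: "1 \<le> m" "m \<le> card I" and s: "filterlim s at_bot F"
  shows "((\<lambda>t. pencil_eigval (insert p I) (rank_one_pert (R t) p (s t)) (P t) m)
    \<longlongrightarrow> pencil_eigval I R' P' (m - 1)) F"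
proof -
  have m': "card I - m < card I" "card I - 1 - (card I - m) = m - 1" using m by auto
  have pcI: "pencil I R' P'" by (rule pencil_subset[OF pc]) auto
  have "((\<lambda>t. pencil_eigval (insert p I) (rank_one_pert (\<lambda>x y. - R t x y) p (- s t)) (P t) (card I - m))
     \<longlongrightarrow> pencil_eigval I (\<lambda>x y. - R' x y) P' (card I - m)) F"
    by (rule tendsto_rank_one_pert_at_top[where R = "\<lambda>t x y. - R t x y"])
      (use s in \<open>auto intro!: pencil_uminus pc pct p tendsto_minus limR limP m'(1) simp: filterlim_uminus_at_bot\<close>)
  from tendsto_minus[OF this] show ?thesis
    unfolding rank_one_pert_uminus[OF m(2)] pencil_eigval_uminus[OF pcI m'(1)] m'(2) by simp
qed

lemma rank_one_pert_first_at_bot: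
  assumes s: "filterlim s at_bot F"
  shows "filterlim (\<lambda>t. pencil_eigval (insert p I) (rank_one_pert (R t) p (s t)) (P t) 0) at_bot F"
proof -
  have "filterlim (\<lambda>t. pencil_eigval (insert p I) (rank_one_pert (\<lambda>x y. - R t x y) p (- s t)) (P t) (card I)) at_top F"
    by (rule rank_one_pert_last_at_top[where R = "\<lambda>t x y. - R t x y" and R' = "\<lambda>x y. - R' x y" and P' = P'])
      (use s in \<open>auto intro!: pencil_uminus pc pct p tendsto_minus limR limP simp: filterlim_uminus_at_bot\<close>)
  then show ?thesis
    by (subst filterlim_uminus_at_bot) (simp add: rank_one_pert_uminus)
qed

end

section \<open>From a pencil to the list of eigenvalues\<close>

lemma sum_functions_apply: "(\<Sum>i\<in>J. h i) n = (\<Sum>i\<in>J. h i n :: 'b::comm_monoid_add)"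
  by (induction J rule: infinite_finite_induct) auto

lemma cseq_dim_combinations:
  assumes "finite J" and indep: "\<And>c. (\<lambda>n. \<Sum>i\<in>J. c i * g i n) = 0 \<Longrightarrow> \<forall>i\<in>J. c i = 0"
  shows "cseq.dim {(\<lambda>n. \<Sum>i\<in>J. c i * g i n) | c. True} = card J"
proof -
  have inj: "inj_on g J"
  proof (rule inj_onI, rule ccontr)
    fix i j assume ij: "i \<in> J" "j \<in> J" "g i = g j" "i \<noteq> j"
    define c where "c k = (if k = i then 1 else if k = j then -1 else 0 :: complex)" for k
    have "(\<Sum>k\<in>J. c k * g k n) = (\<Sum>k\<in>{i,j}. c k * g k n)" for n
      using ij \<open>finite J\<close> by (intro sum.mono_neutral_right) (auto simp: c_def)
    then have "(\<lambda>n. \<Sum>k\<in>J. c k * g k n) = 0" using ij by (auto simp: c_def fun_eq_iff)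
    from indep[OF this] ij(1) show False by (auto simp: c_def)
  qed
  have comb: "(\<Sum>v\<in>g ` J. (\<lambda>n. u v * v n)) = (\<lambda>n. \<Sum>i\<in>J. u (g i) * g i n)" for u
    by (rule ext) (simp add: sum_functions_apply sum.reindex[OF inj])
  have "cseq.independent (g ` J)"
    unfolding cseq.dependent_finite[OF finite_imageI[OF \<open>finite J\<close>]] comb
    by (auto dest!: indep)
  moreover have "cseq.span (g ` J) = {(\<lambda>n. \<Sum>i\<in>J. c i * g i n) | c. True}"
  proof -
    have "\<exists>u. (\<lambda>n. \<Sum>i\<in>J. c i * g i n) = (\<lambda>n. \<Sum>i\<in>J. u (g i) * g i n)" for c
      by (rule exI[of _ "\<lambda>v. c (the_inv_into J g v)"])
        (auto intro!: sum.cong simp: the_inv_into_f_f[OF inj])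
    then show ?thesis
      unfolding cseq.span_finite[OF finite_imageI[OF \<open>finite J\<close>]] comb by (auto simp: image_def)
  qed
  ultimately show ?thesis
    using cseq.dim_eq_card_independent[of "g ` J"] cseq.dim_span[of "g ` J"] card_image[OF inj] by simp
qed

text \<open>Comparing the eigenvalue equation for \<open>x\<close> with that of \<open>e i\<close>
  forces \<open>P x (e i) = 0\<close> whenever \<open>\<mu> i\<close> differs from \<open>l\<close>.
  If no \<open>\<mu> i\<close> equals \<open>l\<close>, the right side is
  \<open>{0}\<close>.\<close>

lemma pencil_eigenspace:
  assumes pc: "pencil I Q P" and es: "full_eig_system I Q P e \<mu>"
  shows "{x \<in> vecs_on I. \<forall>v\<in>vecs_on I. Q x v = l * P x v} =
    {(\<lambda>n. \<Sum>i | i < card I \<and> of_real (\<mu> i) = l. c i * e i n) | c. True}" (is "?L = ?R")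
proof (intro equalityI subsetI)
  note p = pencilD[OF pc]
  let ?J = "{i. i < card I \<and> of_real (\<mu> i) = l}"
  have fin: "finite ?J" by simp
  {
    fix x assume "x \<in> ?L"
    then have x: "x \<in> vecs_on I" "\<And>v. v \<in> vecs_on I \<Longrightarrow> Q x v = l * P x v" by auto
    have z: "P x (e i) = 0" if "i < card I" "of_real (\<mu> i) \<noteq> l" for i
      using eig_systemD(3)[OF es that(1) x(1)] x(2)[OF eig_systemD(1)[OF es that(1)]] that(2) by auto
    have "x = (\<lambda>n. \<Sum>i<card I. P x (e i) * e i n)"
      by (rule eig_system_expand[OF pc es x(1)])
    also have "\<dots> = (\<lambda>n. \<Sum>i\<in>?J. P x (e i) * e i n)"
      by (intro ext sum.mono_neutral_right) (use z in auto)
    finally show "x \<in> ?R" by (intro CollectI exI[of _ "\<lambda>i. P x (e i)"] conjI TrueI)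
  next
    fix x assume "x \<in> ?R"
    then obtain c where x: "x = (\<lambda>n. \<Sum>i\<in>?J. c i * e i n)" by auto
    have "x \<in> vecs_on I"
      unfolding x by (rule vecs_on_sum) (use eig_systemD(1)[OF es] in auto)
    moreover have "Q x v = l * P x v" if v: "v \<in> vecs_on I" for v
    proof -
      have "Q (e i) v = l * P (e i) v" if "i \<in> ?J" for i
        using eig_systemD(3)[OF es _ v, of i] that
        by (subst hermitian_cnj[OF p(2)], subst hermitian_cnj[OF p(3)]) auto
      then show ?thesis
        unfolding x hermitian_sum[OF p(2) fin] hermitian_sum[OF p(3) fin] sum_distrib_left
        by (intro sum.cong) auto
    qed
    ultimately show "x \<in> ?L" by blast
  }
qed

text \<open>Both lists are sorted and have the same multiset of entries.\<close>

lemma concat_replicate_unique: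
  fixes \<mu> :: "nat \<Rightarrow> 'a::linorder"
  assumes mono: "\<And>i j. i \<le> j \<Longrightarrow> j < k \<Longrightarrow> \<mu> i \<le> \<mu> j"
  shows "concat (map (\<lambda>r. replicate (card {i. i < k \<and> \<mu> i = r}) r) (sorted_list_of_set (\<mu> ` {..<k}))) =
    map \<mu> [0..<k]" (is "?L = ?R")
proof -
  let ?m = "\<lambda>r. card {i. i < k \<and> \<mu> i = r}"
  have cnt: "count (mset (concat (map (\<lambda>r. replicate (?m r) r) xs))) x = (if x \<in> set xs then ?m x else 0)"
    if "distinct xs" for xs x
    using that by (induction xs) auto
  have srt: "sorted (concat (map (\<lambda>r. replicate (?m r) r) xs))" if "sorted xs" for xs
    using that by (induction xs) (auto simp: sorted_append)
  have "mset ?L = mset ?R"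
  proof (rule multiset_eqI)
    fix x
    have "count (mset ?R) x = ?m x"
      unfolding count_mset count_list_eq_length_filter length_filter_conv_card
      by (rule arg_cong[where f = card]) auto
    moreover have "?m x = 0" if "x \<notin> \<mu> ` {..<k}" using that by auto
    ultimately show "count (mset ?L) x = count (mset ?R) x"
      by (subst cnt) auto
  qed
  moreover have "sorted ?R" using mono by (auto simp: sorted_iff_nth_mono)
  moreover have "sorted ?L" by (rule srt) simp
  ultimately show ?thesis using properties_for_sort[of ?L ?R] sorted_sort_id[of ?R] by simp
qed

text \<open>\<open>G l\<close> is a linear injective parametrization of the eigenspace by weak
  solutions of the pencil, so it carries over eigenvalues and multiplicities; reality comes from
  \<open>\<mu>\<close> being real. It may depend on \<open>l\<close>, as the Lagrange multiplier
  does.\<close>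

lemma eigenvalue_list_pencil:
  assumes pc: "pencil I Q P"
    and eq: "\<And>l. eigenspace N f q w C l = G l ` {x \<in> vecs_on I. \<forall>v\<in>vecs_on I. Q x v = l * P x v}"
    and lin: "\<And>l J c g. finite (J :: nat set) \<Longrightarrow>
      G l (\<lambda>n. \<Sum>j\<in>J. c j * g j n) = (\<lambda>n. \<Sum>j\<in>J. c j * G l (g j) n)"
    and inj: "\<And>l x. x \<in> vecs_on I \<Longrightarrow> G l x = 0 \<Longrightarrow> x = 0"
  shows "has_exactly_eigenvalues N f q w C (card I)"
    and "eigenvalue_list N f q w C = map (pencil_eigval I Q P) [0..<card I]"
proof -
  let ?\<mu> = "pencil_eigval I Q P" and ?k = "card I"
  obtain e where es: "full_eig_system I Q P e ?\<mu>" using pencil_eigval[OF pc] .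
  let ?J = "\<lambda>l. {i. i < ?k \<and> of_real (?\<mu> i) = (l :: complex)}"
  have fin: "finite (?J l)" for l by simp
  have space: "eigenspace N f q w C l = {(\<lambda>n. \<Sum>i\<in>?J l. c i * G l (e i) n) | c. True}" for l
    unfolding eq pencil_eigenspace[OF pc es] using lin[OF fin] by (auto simp: image_def)
  have indep: "\<forall>i\<in>?J l. c i = 0" if "(\<lambda>n. \<Sum>i\<in>?J l. c i * G l (e i) n) = 0" for c l
  proof -
    let ?x = "\<lambda>n. \<Sum>i\<in>?J l. c i * e i n"
    have "?x \<in> vecs_on I" by (rule vecs_on_sum) (use eig_systemD(1)[OF es] in auto)
    moreover have "G l ?x = 0" using that lin[OF fin] by simp
    ultimately have x: "?x = 0" by (rule inj)
    have "P ?x (e i) = c i" if "i \<in> ?J l" for i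
      by (subst eig_system_coeff[OF pc es]) (use that in auto)
    then show ?thesis unfolding x hermitian_zero[OF pencilD(3)[OF pc]] by simp
  qed
  have mult: "multiplicity_of N f q w C l = card (?J l)" for l
    unfolding multiplicity_of_def space by (rule cseq_dim_combinations[OF fin indep])
  have mult_real: "multiplicity_of N f q w C (of_real r) = card {i. i < ?k \<and> ?\<mu> i = r}" for r
    unfolding mult by simp
  have "l \<in> eigenvalues N f q w C \<longleftrightarrow> ?J l \<noteq> {}" for l
  proof
    assume "l \<in> eigenvalues N f q w C"
    then obtain y n where y: "y \<in> eigenspace N f q w C l" "y n \<noteq> 0" by (auto simp: eigenvalues_def)
    then obtain c where "y = (\<lambda>n. \<Sum>i\<in>?J l. c i * G l (e i) n)" unfolding space by blast
    with y(2) have "(\<Sum>i\<in>?J l. c i * G l (e i) n) \<noteq> 0" by simp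
    then show "?J l \<noteq> {}" by (metis (no_types, lifting) sum.empty)
  next
    assume "?J l \<noteq> {}"
    then have "(\<lambda>n. \<Sum>i\<in>?J l. 1 * G l (e i) n) \<noteq> 0" using indep[of "\<lambda>_. 1" l] by auto
    then obtain n where "(\<Sum>i\<in>?J l. 1 * G l (e i) n) \<noteq> 0" by (auto simp: fun_eq_iff)
    moreover have "(\<lambda>n. \<Sum>i\<in>?J l. 1 * G l (e i) n) \<in> eigenspace N f q w C l"
      unfolding space by (intro CollectI exI[of _ "\<lambda>_. 1"]) simp
    ultimately show "l \<in> eigenvalues N f q w C"
      unfolding eigenvalues_def by (intro CollectI bexI exI)
  qed
  then have ev: "eigenvalues N f q w C = of_real ` ?\<mu> ` {..<?k}" by auto
  have "(\<Sum>l\<in>eigenvalues N f q w C. multiplicity_of N f q w C l) =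
      (\<Sum>r\<in>?\<mu> ` {..<?k}. card {i \<in> {..<?k}. ?\<mu> i = r})"
    unfolding ev by (subst sum.reindex) (auto simp: inj_on_def mult_real)
  also have "\<dots> = card {..<?k}"
    by (subst card_eq_sum, subst sum.image_gen[of _ _ ?\<mu>]) auto
  finally show "has_exactly_eigenvalues N f q w C ?k"
    unfolding has_exactly_eigenvalues_def by (auto simp: ev)
  have "{r. of_real r \<in> eigenvalues N f q w C} = ?\<mu> ` {..<?k}"
    unfolding ev by auto
  then show "eigenvalue_list N f q w C = map ?\<mu> [0..<?k]"
    unfolding eigenvalue_list_def mult_real
    by (simp add: concat_replicate_unique[OF eig_systemD(4)[OF es]])
qed

section \<open>The pencil of a Sturm--Liouville problem\<close>

lemma matrix_bc:
  "blockA M *v vector [v1, v2] + blockB M *v vector [v3, v4] = (\<chi> i. M $ i $ 1 * v1 + M $ i $ 2 * v2 + M $ i $ 3 * v3 + M $ i $ 4 * v4)"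
  by (simp add: vec_eq_iff matrix_vector_mult_def blockA_def blockB_def sum_2)

lemma chart_mat_nth [simp]:
  "chart_mat a z b $ 1 $ 1 = 1" "chart_mat a z b $ 1 $ 2 = of_real a"
  "chart_mat a z b $ 1 $ 3 = cnj z" "chart_mat a z b $ 1 $ 4 = 0"
  "chart_mat a z b $ 2 $ 1 = 0" "chart_mat a z b $ 2 $ 2 = z"
  "chart_mat a z b $ 2 $ 3 = of_real b" "chart_mat a z b $ 2 $ 4 = 1"
  by (simp_all add: chart_mat_def vector_def)

lemma bc_class_self: "M \<in> bc_class M"
proof -
  have "invertible (mat 1 :: complex^2^2)" unfolding invertible_def by (intro exI[of _ "mat 1"]) simp
  then show ?thesis unfolding bc_class_def using matrix_mul_lid[of M] by force
qed

text \<open>Replacing the representative by \<open>T ** M\<close> multiplies the vector of the two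
  rows by \<open>T\<close>, so its vanishing can be read off from \<open>chart_mat\<close>.\<close>

lemma satisfies_bc_chart:
  "satisfies_bc N f (chart a z b) y \<longleftrightarrow>
    y 0 + of_real a * (of_real (f 0) * (y 1 - y 0)) + cnj z * y N = 0 \<and>
    z * (of_real (f 0) * (y 1 - y 0)) + of_real b * y N + of_real (f N) * (y (N + 1) - y N) = 0"
  (is "_ \<longleftrightarrow> ?r1 = 0 \<and> ?r2 = 0")
proof -
  let ?v = "\<lambda>M :: complex^4^2. \<chi> i. M $ i $ 1 * y 0 + M $ i $ 2 * (of_real (f 0) * (y 1 - y 0))
     + M $ i $ 3 * y N + M $ i $ 4 * (of_real (f N) * (y (N + 1) - y N))"
  have "?v (T ** chart_mat a z b) = T *v (vector [?r1, ?r2])" for T :: "complex^2^2"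
    by (simp add: vec_eq_iff matrix_matrix_mult_def matrix_vector_mult_def sum_2 algebra_simps)
  moreover have "?v (chart_mat a z b) = vector [?r1, ?r2]"
    by (simp add: vec_eq_iff forall_2)
  moreover have "vector [?r1, ?r2] = (0 :: complex^2) \<longleftrightarrow> ?r1 = 0 \<and> ?r2 = 0"
    by (simp add: vec_eq_iff forall_2)
  ultimately show ?thesis
    unfolding satisfies_bc_def matrix_bc chart_def
    using bc_class_self[of "chart_mat a z b"] by (auto simp: bc_class_def)
qed

lemma sum_by_parts:
  fixes y v F :: "nat \<Rightarrow> complex"
  assumes "1 \<le> N"
  shows "(\<Sum>n=1..N. - (F n * (y (n + 1) - y n) - F (n - 1) * (y n - y (n - 1))) * v n) =
    (\<Sum>n=1..<N. F n * (y (n + 1) - y n) * (v (n + 1) - v n))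
      + F 0 * (y 1 - y 0) * v 1 - F N * (y (N + 1) - y N) * v N"
  using assms
proof (induction N rule: dec_induct)
  case base
  then show ?case by (simp add: algebra_simps)
next
  case (step N)
  then show ?case by (simp add: algebra_simps)
qed

locale sturm_liouville =
  fixes N :: nat and f q w :: "nat \<Rightarrow> real"
  assumes N2: "2 \<le> N" and f_nonzero: "\<And>n. n \<le> N \<Longrightarrow> f n \<noteq> 0"
    and w_pos: "\<And>n. 1 \<le> n \<Longrightarrow> n \<le> N \<Longrightarrow> 0 < w n"
begin

text \<open>In the coordinate \<open>x\<^sub>1 = y\<^sub>1 + cnj z * y\<^sub>N\<close> the space of the degenerate case
  \<open>a\<^sub>1\<^sub>2 = 1 / f\<^sub>0\<close> no longer depends on \<open>z\<close>; \<open>shear\<close> recovers \<open>y\<close> from \<open>x\<close>.\<close>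

definition shear :: "complex \<Rightarrow> (nat \<Rightarrow> complex) \<Rightarrow> nat \<Rightarrow> complex" where
  "shear z x n = (if n = 1 then x 1 - cnj z * x N else x n)"

text \<open>What summation by parts leaves after the second boundary row has replaced
  \<open>f N * (y (N + 1) - y N)\<close>, apart from the term in \<open>f 0 * (y 1 - y 0)\<close>.
  It does not involve \<open>a12\<close>.\<close>

definition R_form :: "complex \<Rightarrow> real \<Rightarrow> (nat \<Rightarrow> complex) \<Rightarrow> (nat \<Rightarrow> complex) \<Rightarrow> complex" where
  "R_form z b x v =
     (\<Sum>n=1..<N. of_real (f n) * (shear z x (n + 1) - shear z x n) * cnj (shear z v (n + 1) - shear z v n))
     + (\<Sum>n=1..N. of_real (q n) * shear z x n * cnj (shear z v n)) + of_real b * x N * cnj (v N)"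

definition P_form :: "complex \<Rightarrow> (nat \<Rightarrow> complex) \<Rightarrow> (nat \<Rightarrow> complex) \<Rightarrow> complex" where
  "P_form z x v = (\<Sum>n=1..N. of_real (w n) * shear z x n * cnj (shear z v n))"

definition residual :: "complex \<Rightarrow> (nat \<Rightarrow> complex) \<Rightarrow> nat \<Rightarrow> complex" where
  "residual l y n = - (of_real (f n) * (y (n + 1) - y n) - of_real (f (n - 1)) * (y n - y (n - 1)))
     + of_real (q n) * y n - l * of_real (w n) * y n"

text \<open>The sequence with interior values \<open>shear z x\<close> and \<open>f\<^sub>0 \<Delta> y\<^sub>0 = p\<close> that satisfies the second
  row of the boundary condition.\<close>

definition extension :: "complex \<Rightarrow> real \<Rightarrow> (nat \<Rightarrow> complex) \<Rightarrow> complex \<Rightarrow> nat \<Rightarrow> complex" where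
  "extension z b x p n =
     (if n = 0 then shear z x 1 - p / of_real (f 0)
      else if n \<le> N then shear z x n
      else if n = N + 1 then x N - (z * p + of_real b * x N) / of_real (f N) else 0)"

lemma shear_add: "shear z (x + y) n = shear z x n + shear z y n"
  and shear_scale: "shear z (\<lambda>n. c * x n) n = c * shear z x n"
  by (auto simp: shear_def algebra_simps)

lemma shear_N [simp]: "shear z x N = x N"
  using N2 by (simp add: shear_def)

lemma hermitian_R_form: "hermitian_form (R_form z b)"
proof (rule hermitian_formI)
  show "R_form z b (x + y) v = R_form z b x v + R_form z b y v" for x y v
    unfolding R_form_def shear_add by (simp add: algebra_simps sum.distrib sum_subtractf)
  show "R_form z b (\<lambda>n. c * x n) v = c * R_form z b x v" for c x v
    unfolding R_form_def shear_scale by (simp add: algebra_simps sum_distrib_left)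
  show "R_form z b y x = cnj (R_form z b x y)" for x y
    unfolding R_form_def by (simp add: mult_ac)
qed

lemma hermitian_P_form: "hermitian_form (P_form z)"
proof (rule hermitian_formI)
  show "P_form z (x + y) v = P_form z x v + P_form z y v" for x y v
    unfolding P_form_def shear_add by (simp add: algebra_simps sum.distrib)
  show "P_form z (\<lambda>n. c * x n) v = c * P_form z x v" for c x v
    unfolding P_form_def shear_scale by (simp add: algebra_simps sum_distrib_left)
  show "P_form z y x = cnj (P_form z x y)" for x y
    unfolding P_form_def by (simp add: mult_ac)
qed

lemma shear_eq_0:
  assumes "x \<in> vecs_on {1..N}" "\<And>n. n \<in> {1..N} \<Longrightarrow> shear z x n = 0"
  shows "x = 0"
proof
  fix n
  have "x N = 0" using assms(2)[of N] N2 by simp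
  then show "x n = 0 n"
    using assms(1) assms(2)[of n] by (cases "n \<in> {1..N}") (auto simp: vecs_on_def shear_def split: if_splits)
qed

lemma pencil_sl: "pencil {1..N} (R_form z b) (P_form z)"
  unfolding pencil_def
proof (intro conjI ballI impI hermitian_R_form hermitian_P_form)
  fix x assume x: "x \<in> vecs_on {1..N}" "x \<noteq> 0"
  have "qf (P_form z) x = (\<Sum>n=1..N. w n * (cmod (shear z x n))\<^sup>2)"
    unfolding qf_def P_form_def Re_sum
    by (intro sum.cong) (simp_all add: mult.assoc flip: complex_norm_square)
  moreover obtain n where "n \<in> {1..N}" "shear z x n \<noteq> 0"
    using shear_eq_0[OF x(1)] x(2) by blast
  ultimately show "0 < qf (P_form z) x"
    using w_pos by (auto intro!: sum_pos2[of _ n] mult_nonneg_nonneg simp: less_imp_le)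
qed simp

lemma interval_insert: "{1..N} = insert 1 {2..N}"
  using N2 by auto

lemma pencil_sl2: "pencil {2..N} (R_form z b) (P_form z)"
  by (rule pencil_subset[OF pencil_sl]) auto

lemma extension_simps:
  "extension z b x p 0 = shear z x 1 - p / of_real (f 0)"
  "1 \<le> n \<Longrightarrow> n \<le> N \<Longrightarrow> extension z b x p n = shear z x n"
  "extension z b x p (N + 1) = x N - (z * p + of_real b * x N) / of_real (f N)"
  "of_real (f 0) * (extension z b x p 1 - extension z b x p 0) = p"
  "of_real (f N) * (extension z b x p (N + 1) - extension z b x p N) = - (z * p + of_real b * x N)"
  using N2 f_nonzero by (simp_all add: extension_def shear_def)

text \<open>The end at \<open>N\<close> contributes \<open>z * p * cnj (v N)\<close>, and
  \<open>cnj (shear z v 1) = cnj (v 1) - z * cnj (v N)\<close> contributes its negative. This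
  cancellation leaves \<open>p\<close> paired with \<open>v 1\<close> alone, and is what the sheared
  coordinate achieves.\<close>

lemma sum_residual:
  "(\<Sum>n=1..N. residual l (extension z b x p) n * cnj (shear z v n)) =
     R_form z b x v - l * P_form z x v + p * cnj (v 1)"
proof -
  let ?y = "extension z b x p" and ?u = "\<lambda>n. cnj (shear z v n)"
  have "(\<Sum>n=1..N. residual l ?y n * ?u n) =
      (\<Sum>n=1..N. - (of_real (f n) * (?y (n + 1) - ?y n) - of_real (f (n - 1)) * (?y n - ?y (n - 1))) * ?u n)
      + (\<Sum>n=1..N. of_real (q n) * ?y n * ?u n) - l * (\<Sum>n=1..N. of_real (w n) * ?y n * ?u n)"
    unfolding residual_def by (simp add: algebra_simps sum.distrib sum_subtractf sum_distrib_left)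
  also have "(\<Sum>n=1..N. - (of_real (f n) * (?y (n + 1) - ?y n) - of_real (f (n - 1)) * (?y n - ?y (n - 1))) * ?u n)
     = (\<Sum>n=1..<N. of_real (f n) * (?y (n + 1) - ?y n) * (?u (n + 1) - ?u n))
      + of_real (f 0) * (?y 1 - ?y 0) * ?u 1 - of_real (f N) * (?y (N + 1) - ?y N) * ?u N"
    by (rule sum_by_parts) (use N2 in simp)
  also have "(\<Sum>n=1..<N. of_real (f n) * (?y (n + 1) - ?y n) * (?u (n + 1) - ?u n)) =
      (\<Sum>n=1..<N. of_real (f n) * (shear z x (n + 1) - shear z x n) * cnj (shear z v (n + 1) - shear z v n))"
    by (intro sum.cong) (auto simp: extension_simps)
  also have "(\<Sum>n=1..N. of_real (q n) * ?y n * ?u n) = (\<Sum>n=1..N. of_real (q n) * shear z x n * ?u n)"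
    by (intro sum.cong) (auto simp: extension_simps)
  also have "(\<Sum>n=1..N. of_real (w n) * ?y n * ?u n) = P_form z x v"
    unfolding P_form_def by (intro sum.cong) (auto simp: extension_simps)
  also have "of_real (f 0) * (?y 1 - ?y 0) = p" by (rule extension_simps)
  also have "of_real (f N) * (?y (N + 1) - ?y N) = - (z * p + of_real b * x N)" by (rule extension_simps)
  finally show ?thesis
    by (simp add: R_form_def shear_def[of z v "Suc 0"] algebra_simps)
qed

lemma sum_shear_unit_vec:
  assumes "k \<in> {1..N}"
  shows "(\<Sum>n=1..N. r n * cnj (shear z (unit_vec k) n)) = r k - (if k = N then z * r 1 else 0)"
proof -
  have "(\<Sum>n=1..N. r n * cnj (shear z (unit_vec k) n)) =
      (\<Sum>n=1..N. (if n = k then r n else 0) - (if n = 1 then if k = N then z * r n else 0 else 0))"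
    using N2 by (intro sum.cong) (auto simp: shear_def unit_vec_def)
  also have "\<dots> = r k - (if k = N then z * r 1 else 0)"
    unfolding sum_subtractf using assms N2 by auto
  finally show ?thesis .
qed

text \<open>The unit vectors form a triangular system of tests: \<open>unit_vec N\<close> yields
  \<open>r N - z * r 1\<close>, every other one yields \<open>r k\<close>. For
  \<open>J = {2..N}\<close> the equation at \<open>1\<close> must be supplied separately.\<close>

lemma residual_zero_iff:
  assumes "insert 1 J = {1..N}" "1 \<notin> J \<Longrightarrow> r 1 = 0"
  shows "(\<forall>n\<in>{1..N}. r n = 0) \<longleftrightarrow> (\<forall>v\<in>vecs_on J. (\<Sum>n=1..N. r n * cnj (shear z v n)) = 0)"
proof
  assume R: "\<forall>v\<in>vecs_on J. (\<Sum>n=1..N. r n * cnj (shear z v n)) = 0"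
  have *: "r k = (if k = N then z * r 1 else 0)" if "k \<in> J" for k
  proof -
    have "k \<in> {1..N}" using assms(1) that by auto
    from sum_shear_unit_vec[OF this, of r z] show ?thesis
      using R[rule_format, OF unit_vec_vecs_on[OF that]] by simp
  qed
  have "r 1 = 0" using *[of 1] assms(2) N2 by (cases "1 \<in> J") auto
  then show "\<forall>n\<in>{1..N}. r n = 0" using * unfolding assms(1)[symmetric] by auto
qed simp

text \<open>The second row is built into \<open>extension\<close>, and the first becomes
  \<open>x 1 = - c * p\<close>. Since nothing is divided by \<open>c\<close>, the degenerate case is
  included.\<close>

lemma eigenspace_chart:
  "eigenspace N f q w (chart (1 / f 0 + c) z b) l =
    {extension z b x p | x p. x \<in> vecs_on {1..N} \<and> x 1 = - of_real c * p \<and>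
      (\<forall>n\<in>{1..N}. residual l (extension z b x p) n = 0)}" (is "?L = ?R")
proof (intro equalityI subsetI)
  have sol: "solves_equation N f q w l y \<longleftrightarrow> (\<forall>n\<in>{1..N}. residual l y n = 0)" for y
    unfolding solves_equation_def residual_def by auto
  have f0: "f 0 \<noteq> 0" "f N \<noteq> 0" using f_nonzero by auto
  have row1: "y 0 + of_real (1 / f 0 + c) * (of_real (f 0) * (y 1 - y 0)) + cnj z * y N
     = y 1 + cnj z * y N + of_real c * (of_real (f 0) * (y 1 - y 0))" for y :: "nat \<Rightarrow> complex"
    using f0 by (simp add: field_simps)
  {
    fix y assume "y \<in> ?L"
    then have y: "\<And>n. n > N + 1 \<Longrightarrow> y n = 0" "\<forall>n\<in>{1..N}. residual l y n = 0"
      "y 1 + cnj z * y N + of_real c * (of_real (f 0) * (y 1 - y 0)) = 0"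
      "z * (of_real (f 0) * (y 1 - y 0)) + of_real b * y N + of_real (f N) * (y (N + 1) - y N) = 0"
      unfolding eigenspace_def mem_Collect_eq sol satisfies_bc_chart row1 by auto
    define p where "p = of_real (f 0) * (y 1 - y 0)"
    define x where "x n = (if n = 1 then y 1 + cnj z * y N else if n \<in> {1..N} then y n else 0)" for n
    have "y = extension z b x p"
    proof
      fix n
      have "x N = y N" using N2 by (simp add: x_def)
      moreover have "y (N + 1) = y N - (z * p + of_real b * y N) / of_real (f N)"
        using y(4) f0 unfolding p_def[symmetric] by (simp add: field_simps)
      moreover have "y 0 = y 1 - p / of_real (f 0)" using f0 by (simp add: p_def)
      ultimately show "y n = extension z b x p n"
        using y(1)[of n] N2 by (auto simp: extension_def shear_def x_def)
    qed
    moreover have "x \<in> vecs_on {1..N}" using N2 by (auto simp: x_def vecs_on_def)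
    moreover have "x 1 = - of_real c * p"
      using y(3) unfolding p_def[symmetric] by (simp add: x_def eq_neg_iff_add_eq_0)
    ultimately show "y \<in> ?R" using y(2) by blast
  next
    fix y assume "y \<in> ?R"
    then obtain x p where y: "y = extension z b x p" and x: "x \<in> vecs_on {1..N}" "x 1 = - of_real c * p"
      and res: "\<forall>n\<in>{1..N}. residual l y n = 0" by blast
    have "y 1 + cnj z * y N = x 1" using N2 by (simp add: y extension_simps shear_def)
    then have "satisfies_bc N f (chart (1 / f 0 + c) z b) y"
      unfolding satisfies_bc_chart row1 unfolding y extension_simps(4,5)
      using x(2) N2 by (simp add: extension_simps(2))
    moreover have "\<forall>n>N + 1. y n = 0" by (simp add: y extension_def)
    ultimately show "y \<in> ?L" using res unfolding eigenspace_def sol by blast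
  }
qed

lemma extension_linear:
  assumes "finite J"
  shows "extension z b (\<lambda>n. \<Sum>j\<in>J. c j * g j n) (\<Sum>j\<in>J. c j * p j) =
    (\<lambda>n. \<Sum>j\<in>J. c j * extension z b (g j) (p j) n)"
proof
  fix n
  have sh: "shear z (\<lambda>n. \<Sum>j\<in>J. c j * g j n) n = (\<Sum>j\<in>J. c j * shear z (g j) n)" for n
    by (simp add: shear_def sum_distrib_left algebra_simps sum_subtractf)
  show "extension z b (\<lambda>n. \<Sum>j\<in>J. c j * g j n) (\<Sum>j\<in>J. c j * p j) n =
    (\<Sum>j\<in>J. c j * extension z b (g j) (p j) n)"
    unfolding extension_def sh
    by (auto simp: sum_distrib_left sum_divide_distrib add_divide_distrib algebra_simps sum_subtractf sum.distrib)
qed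

lemma extension_eq_0: "x \<in> vecs_on {1..N} \<Longrightarrow> extension z b x p = 0 \<Longrightarrow> x = 0"
  using extension_simps(2)[of _ z b x p] by (intro shear_eq_0[of x z]) auto

lemma eigenvalues_nondegenerate:
  assumes "c \<noteq> 0"
  shows "has_exactly_eigenvalues N f q w (chart (1 / f 0 + c) z b) N"
    and "eigenvalue_list N f q w (chart (1 / f 0 + c) z b) =
      map (pencil_eigval {1..N} (rank_one_pert (R_form z b) 1 (- 1 / c)) (P_form z)) [0..<N]"
proof -
  let ?Q = "rank_one_pert (R_form z b) 1 (- 1 / c)"
  let ?G = "\<lambda>l x. extension z b x (of_real (- 1 / c) * x 1)"
  have eq: "eigenspace N f q w (chart (1 / f 0 + c) z b) l =
     ?G l ` {x \<in> vecs_on {1..N}. \<forall>v\<in>vecs_on {1..N}. ?Q x v = l * P_form z x v}" for l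
  proof -
    \<comment> \<open>For \<open>c \<noteq> 0\<close> the first row determines \<open>p\<close>, and
      \<open>p * cnj (v 1)\<close> becomes the rank-one term with coefficient
      \<open>- 1 / c\<close>.\<close>
    have "x 1 = - of_real c * p \<longleftrightarrow> p = of_real (- 1 / c) * x 1" for p :: complex and x :: "nat \<Rightarrow> complex"
      using assms by (auto simp: field_simps)
    then have "eigenspace N f q w (chart (1 / f 0 + c) z b) l =
        ?G l ` {x \<in> vecs_on {1..N}. \<forall>n\<in>{1..N}. residual l (?G l x) n = 0}"
      unfolding eigenspace_chart by (auto simp: image_def)
    moreover have "(\<forall>n\<in>{1..N}. residual l (?G l x) n = 0) \<longleftrightarrow>
        (\<forall>v\<in>vecs_on {1..N}. ?Q x v = l * P_form z x v)" for x
    proof (subst residual_zero_iff[of "{1..N}" _ z])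
      have "(\<Sum>n=1..N. residual l (?G l x) n * cnj (shear z v n)) = ?Q x v - l * P_form z x v" for v
        unfolding sum_residual by simp
      then show "(\<forall>v\<in>vecs_on {1..N}. (\<Sum>n=1..N. residual l (?G l x) n * cnj (shear z v n)) = 0) \<longleftrightarrow>
          (\<forall>v\<in>vecs_on {1..N}. ?Q x v = l * P_form z x v)"
        by simp
    qed (use N2 in auto)
    ultimately show ?thesis by (simp only:)
  qed
  have lin: "?G l (\<lambda>n. \<Sum>j\<in>J. k j * g j n) = (\<lambda>n. \<Sum>j\<in>J. k j * ?G l (g j) n)"
    if "finite J" for l :: complex and k g and J :: "nat set"
    by (subst extension_linear[OF that, symmetric]) (simp add: sum_distrib_left mult_ac)
  have inj: "x \<in> vecs_on {1..N} \<Longrightarrow> ?G l x = 0 \<Longrightarrow> x = 0" for l :: complex and x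
    by (rule extension_eq_0)
  note * = eigenvalue_list_pencil[where G = ?G, OF pencil_rank_one_pert[OF pencil_sl] eq lin inj]
  show "has_exactly_eigenvalues N f q w (chart (1 / f 0 + c) z b) N"
    using *(1) by simp
  show "eigenvalue_list N f q w (chart (1 / f 0 + c) z b) =
      map (pencil_eigval {1..N} (rank_one_pert (R_form z b) 1 (- 1 / c)) (P_form z)) [0..<N]"
    using *(2) by simp
qed

text \<open>In the degenerate case \<open>p = f\<^sub>0 \<Delta> y\<^sub>0\<close> is a Lagrange multiplier, determined by the equation
  at \<open>n = 1\<close>.\<close>

definition multiplier :: "complex \<Rightarrow> complex \<Rightarrow> (nat \<Rightarrow> complex) \<Rightarrow> complex" where
  "multiplier l z x = of_real (f 1) * (shear z x 2 - shear z x 1) - of_real (q 1) * shear z x 1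
     + l * of_real (w 1) * shear z x 1"

lemma residual_1: "residual l (extension z b x p) 1 = p - multiplier l z x"
  using extension_simps(4)[of z b x p] N2
  by (simp add: residual_def multiplier_def extension_simps(2) numeral_2_eq_2 algebra_simps)

lemma vecs_on_2: "vecs_on {2..N} = {x \<in> vecs_on {1..N}. x 1 = 0}"
  using N2 by (auto simp: vecs_on_def) (metis le_antisym not_less_eq_eq numeral_2_eq_2)

text \<open>Test vectors with \<open>v 1 = 0\<close> do not see \<open>p\<close>; the choice of the
  multiplier takes care of the equation at \<open>1\<close>.\<close>

lemma residual_degenerate_iff:
  "(\<forall>n\<in>{1..N}. residual l (extension z b x (multiplier l z x)) n = 0) \<longleftrightarrow>
     (\<forall>v\<in>vecs_on {2..N}. R_form z b x v = l * P_form z x v)"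
proof (subst residual_zero_iff[of "{2..N}" _ z])
  show "insert 1 {2..N} = {1..N}" using N2 by auto
  show "residual l (extension z b x (multiplier l z x)) 1 = 0" using residual_1 by simp
  show "(\<forall>v\<in>vecs_on {2..N}. (\<Sum>n=1..N. residual l (extension z b x (multiplier l z x)) n * cnj (shear z v n)) = 0)
    \<longleftrightarrow> (\<forall>v\<in>vecs_on {2..N}. R_form z b x v = l * P_form z x v)"
    unfolding sum_residual by (auto simp: vecs_on_2)
qed

lemma eigenvalues_degenerate:
  shows "has_exactly_eigenvalues N f q w (chart (1 / f 0) z b) (N - 1)"
    and "eigenvalue_list N f q w (chart (1 / f 0) z b) =
      map (pencil_eigval {2..N} (R_form z b) (P_form z)) [0..<N - 1]"
proof -
  let ?G = "\<lambda>l x. extension z b x (multiplier l z x)"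
  have eq: "eigenspace N f q w (chart (1 / f 0) z b) l =
     ?G l ` {x \<in> vecs_on {2..N}. \<forall>v\<in>vecs_on {2..N}. R_form z b x v = l * P_form z x v}" for l
  proof -
    \<comment> \<open>The residual at \<open>1\<close> is \<open>p\<close> minus the multiplier, so
      a solution leaves no freedom in \<open>p\<close>.\<close>
    have "p = multiplier l z x" if "\<forall>n\<in>{1..N}. residual l (extension z b x p) n = 0" for x p
      using that[rule_format, of 1] residual_1[of l z b x p] N2 by simp
    then have "{extension z b x p | x p. x \<in> vecs_on {2..N} \<and> (\<forall>n\<in>{1..N}. residual l (extension z b x p) n = 0)}
      = ?G l ` {x \<in> vecs_on {2..N}. \<forall>n\<in>{1..N}. residual l (?G l x) n = 0}"
      by (auto simp: image_def)
    moreover have "eigenspace N f q w (chart (1 / f 0) z b) l =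
      {extension z b x p | x p. x \<in> vecs_on {2..N} \<and> (\<forall>n\<in>{1..N}. residual l (extension z b x p) n = 0)}"
      using eigenspace_chart[of 0 z b l] vecs_on_2 by auto
    ultimately show ?thesis by (simp only: residual_degenerate_iff)
  qed
  have lin: "?G l (\<lambda>n. \<Sum>j\<in>J. k j * g j n) = (\<lambda>n. \<Sum>j\<in>J. k j * ?G l (g j) n)"
    if "finite J" for l :: complex and k g and J :: "nat set"
    by (subst extension_linear[OF that, symmetric])
      (simp add: multiplier_def shear_def sum_distrib_left algebra_simps sum_subtractf sum.distrib)
  have inj: "x \<in> vecs_on {2..N} \<Longrightarrow> ?G l x = 0 \<Longrightarrow> x = 0" for l :: complex and x
    using extension_eq_0 vecs_on_2 by blast
  note * = eigenvalue_list_pencil[where G = ?G, OF pencil_sl2 eq lin inj]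
  show "has_exactly_eigenvalues N f q w (chart (1 / f 0) z b) (N - 1)"
    using *(1) N2 by (simp add: Suc_diff_le numeral_2_eq_2)
  show "eigenvalue_list N f q w (chart (1 / f 0) z b) =
      map (pencil_eigval {2..N} (R_form z b) (P_form z)) [0..<N - 1]"
    using *(2) N2 by (simp add: Suc_diff_le numeral_2_eq_2)
qed

end

section \<open>Coordinates on the chart\<close>

text \<open>The Pluecker coordinates of the row space. On \<open>chart_mat\<close> the minor of
  columns 1 and 4 is \<open>1\<close>.\<close>

definition minor :: "4 \<Rightarrow> 4 \<Rightarrow> complex^4^2 \<Rightarrow> complex" where
  "minor i j M = M $ 1 $ i * M $ 2 $ j - M $ 1 $ j * M $ 2 $ i"

text \<open>Row operations multiply all minors by the same factor, so their quotients are defined on classes.\<close>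

definition coord :: "4 \<Rightarrow> 4 \<Rightarrow> (complex^4^2) set \<Rightarrow> complex" where
  "coord i j C = (let M = SOME M. M \<in> C in minor i j M / minor 1 4 M)"

lemma minor_mult: "minor i j (T ** M) = det T * minor i j M"
  by (simp add: minor_def matrix_matrix_mult_def sum_2 det_2 algebra_simps)

lemma some_in_bc_class:
  obtains T :: "complex^2^2" where "det T \<noteq> 0" "(SOME N. N \<in> bc_class M) = T ** M"
proof -
  have "(SOME N. N \<in> bc_class M) \<in> bc_class M"
    using bc_class_self by (rule someI)
  then show thesis using that invertible_det_nz unfolding bc_class_def by blast
qed

lemma coord_bc_class: "coord i j (bc_class M) = minor i j M / minor 1 4 M"
  by (rule some_in_bc_class[of M]) (simp add: coord_def minor_mult)

lemma coord_chart:
  "coord 2 4 (chart a z b) = of_real a" "coord 1 2 (chart a z b) = z"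
  "coord 1 3 (chart a z b) = of_real b"
  unfolding chart_def coord_bc_class by (simp_all add: minor_def)

lemma chart_eq_iff: "chart a z b = chart a' z' b' \<longleftrightarrow> a = a' \<and> z = z' \<and> b = b'"
  by (metis coord_chart of_real_eq_iff)

text \<open>Quotients of minors are invariant under row operations, so the set of matrices is
  saturated and openness upstairs descends to the quotient.\<close>

lemma openin_minor:
  assumes "open W"
  shows "openin bc_quotient_topology (bc_class ` {M \<in> rank2_mats. minor 1 4 M \<noteq> 0 \<and> minor i j M / minor 1 4 M \<in> W})"
    (is "openin _ (bc_class ` ?S)")
proof -
  have inS: "M \<in> ?S" if M: "M \<in> rank2_mats" and "bc_class M \<in> bc_class ` ?S" for M
  proof -
    obtain M' where M': "bc_class M = bc_class M'" "M' \<in> ?S" using \<open>bc_class M \<in> bc_class ` ?S\<close> by blast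
    have "M' \<in> bc_class M" using bc_class_self[of M'] M'(1) by simp
    then obtain T :: "complex^2^2" where "det T \<noteq> 0" "M' = T ** M"
      unfolding bc_class_def using invertible_det_nz by blast
    then show ?thesis using M M' by (simp add: minor_mult)
  qed
  have "{M \<in> rank2_mats. bc_class M \<in> bc_class ` ?S} = ?S"
    using inS by (intro equalityI subsetI) auto
  moreover have "open {M. minor 1 4 M \<noteq> 0 \<and> minor i j M / minor 1 4 M \<in> W}"
  proof -
    have cont: "continuous_on UNIV (minor i j)" for i j
      unfolding minor_def by (intro continuous_intros)
    have "open {M. minor 1 4 M \<noteq> 0}"
      by (intro open_Collect_neq cont continuous_on_const)
    moreover have "continuous_on {M. minor 1 4 M \<noteq> 0} (\<lambda>M. minor i j M / minor 1 4 M)"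
      by (intro continuous_on_divide continuous_on_subset[OF cont subset_UNIV]) auto
    ultimately have "open ((\<lambda>M. minor i j M / minor 1 4 M) -` W \<inter> {M. minor 1 4 M \<noteq> 0})"
      using assms continuous_on_open_vimage by blast
    then show ?thesis by (simp add: Int_def vimage_def conj_commute)
  qed
  ultimately show ?thesis
    unfolding openin_bc_quotient_topology openin_open by auto
qed

lemma chart_mat_rank: "chart_mat a z b \<in> rank2_mats"
proof -
  let ?M = "chart_mat a z b"
  have rows: "rows ?M = {row 1 ?M, row 2 ?M}" unfolding rows_def by auto (metis exhaust_2)
  have row: "row i ?M $ k = ?M $ i $ k" for i k by (simp add: row_def)
  have "row 1 ?M \<noteq> k *s row 2 ?M" for k
    by (auto simp: vec_eq_iff row intro: exI[of _ 1])
  moreover have nz: "row 2 ?M \<noteq> 0"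
    by (auto simp: vec_eq_iff row intro: exI[of _ 4])
  ultimately have "vec.independent {row 1 ?M, row 2 ?M}" "row 1 ?M \<noteq> row 2 ?M"
    by (auto simp: vec.independent_insert vec.span_singleton vec.dependent_single)
      (metis vector_smult_lid)
  then have "vec.dim (rows ?M) = 2"
    unfolding rows by (simp add: vec.dim_eq_card_independent)
  then show ?thesis unfolding rank2_mats_def row_rank_def_gen by simp
qed

lemma chart_self_adjoint: "chart a z b \<in> self_adjoint_bcs"
proof -
  let ?M = "chart_mat a z b"
  have "blockA ?M ** J2 ** adjoint_mat (blockA ?M) = blockB ?M ** J2 ** adjoint_mat (blockB ?M)"
    by (simp add: vec_eq_iff forall_2 matrix_matrix_mult_def sum_2 blockA_def blockB_def J2_def adjoint_mat_def)
  then show ?thesis using chart_mat_rank unfolding self_adjoint_bcs_def chart_def by blast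
qed

lemma topspace_bc_topology: "topspace bc_topology = self_adjoint_bcs"
  unfolding bc_topology_def topspace_subtopology topspace_bc_quotient_topology self_adjoint_bcs_def
  by auto

text \<open>Reduces limits in the quotient topology to limits of the real and complex parameters of
  the chart.\<close>

lemma tendsto_coord:
  "(coord i j \<longlongrightarrow> coord i j (chart a z b)) (atin_within bc_topology (chart a z b) S)"
proof (rule topological_tendstoI)
  fix W assume W: "open W" "coord i j (chart a z b) \<in> W"
  let ?U = "bc_class ` {M \<in> rank2_mats. minor 1 4 M \<noteq> 0 \<and> minor i j M / minor 1 4 M \<in> W}"
  have "openin bc_topology (?U \<inter> self_adjoint_bcs)"
    unfolding bc_topology_def using openin_minor[OF W(1)] by (rule openin_subtopology_Int)
  moreover have "chart a z b \<in> ?U \<inter> self_adjoint_bcs"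
    using W(2) chart_mat_rank[of a z b] chart_self_adjoint[of a z b]
    unfolding chart_def coord_bc_class by (auto simp: minor_def)
  moreover have "coord i j C \<in> W" if "C \<in> ?U" for C using that by (auto simp: coord_bc_class)
  ultimately show "\<forall>\<^sub>F C in atin_within bc_topology (chart a z b) S. coord i j C \<in> W"
    unfolding eventually_atin_within by blast
qed

lemma tendsto_chart_coordinates:
  "((\<lambda>C. Re (coord 2 4 C)) \<longlongrightarrow> a) (atin_within bc_topology (chart a z b) S)"
  "(coord 1 2 \<longlongrightarrow> z) (atin_within bc_topology (chart a z b) S)"
  "((\<lambda>C. Re (coord 1 3 C)) \<longlongrightarrow> b) (atin_within bc_topology (chart a z b) S)"
  using tendsto_Re[OF tendsto_coord[of 2 4 a z b S]] tendsto_coord[of 1 2 a z b S]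
    tendsto_Re[OF tendsto_coord[of 1 3 a z b S]] by (simp_all add: coord_chart)

lemma eventually_atin_within_mem: "\<forall>\<^sub>F x in atin_within X a S. x \<in> S"
  unfolding eventually_atin_within using openin_topspace by blast

lemma filterlim_atin_within_Un:
  assumes "filterlim g G (atin_within X a S)" "filterlim g G (atin_within X a S')"
  shows "filterlim g G (atin_within X a (S \<union> S'))"
  unfolding filterlim_iff
proof (intro allI impI)
  fix P assume "eventually P G"
  then have "\<forall>\<^sub>F x in atin X a. x \<in> S \<longrightarrow> P (g x)" "\<forall>\<^sub>F x in atin X a. x \<in> S' \<longrightarrow> P (g x)"
    using assms unfolding filterlim_iff eventually_within_imp[of _ X a S] eventually_within_imp[of _ X a S']
    by blast+
  then have "\<forall>\<^sub>F x in atin X a. x \<in> S \<union> S' \<longrightarrow> P (g x)"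
    by eventually_elim auto
  then show "\<forall>\<^sub>F x in atin_within X a (S \<union> S'). P (g x)"
    unfolding eventually_within_imp[of _ X a "S \<union> S'"] .
qed

lemma continuous_map_chart: "continuous_map euclideanreal bc_topology (\<lambda>a. chart a z b)"
proof -
  have "continuous_on UNIV (\<lambda>a. chart_mat a z b)"
  proof -
    have "continuous_on UNIV (\<lambda>a. chart_mat a z b $ i $ k)" for i k
    proof -
      have "continuous_on UNIV (\<lambda>a. complex_of_real a)" by (intro continuous_intros)
      then show ?thesis
        using exhaust_2[of i] exhaust_4[of k] by (elim disjE) simp_all
    qed
    then show ?thesis
      by (intro continuous_on_vec_lambda[of UNIV "\<lambda>i a. chart_mat a z b $ i", simplified] 
          continuous_on_vec_lambda[of UNIV "\<lambda>k a. chart_mat a z b $ i $ k" for i, simplified])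
  qed
  then have "continuous_map euclideanreal (top_of_set rank2_mats) (\<lambda>a. chart_mat a z b)"
    using chart_mat_rank by (auto simp: continuous_map_in_subtopology)
  then have "continuous_map euclideanreal bc_quotient_topology (bc_class \<circ> (\<lambda>a. chart_mat a z b))"
    using quotient_imp_continuous_map[OF quotient_map_bc_class] by (rule continuous_map_compose)
  then show ?thesis
    unfolding bc_topology_def continuous_map_in_subtopology
    using chart_self_adjoint by (auto simp: chart_def o_def)
qed

text \<open>Raising \<open>a12\<close> slightly above \<open>1 / f 0\<close> reaches
  \<open>B14_plus\<close> inside every neighbourhood. Uniqueness of limits along this filter rests
  on it.\<close>

lemma B14_plus_nontrivial: "atin_within bc_topology (chart (1 / f 0) z b) (B14_plus f) \<noteq> bot"
proof
  assume "atin_within bc_topology (chart (1 / f 0) z b) (B14_plus f) = bot"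
  then have "\<forall>\<^sub>F C in atin_within bc_topology (chart (1 / f 0) z b) (B14_plus f). False" by simp
  then have "\<exists>T. openin bc_topology T \<and> chart (1 / f 0) z b \<in> T \<and>
      (\<forall>C\<in>T. C \<in> B14_plus f \<longrightarrow> C = chart (1 / f 0) z b)"
    by (simp add: eventually_atin_within topspace_bc_topology chart_self_adjoint)
  then obtain T where T: "openin bc_topology T" "chart (1 / f 0) z b \<in> T"
    "\<And>C. C \<in> T \<Longrightarrow> C \<in> B14_plus f \<Longrightarrow> C = chart (1 / f 0) z b"
    by blast
  have "open {a. chart a z b \<in> T}"
    using continuous_map_chart[of z b] T(1) unfolding continuous_map_def by auto
  then obtain e where e: "e > 0" "\<And>a. dist a (1 / f 0) < e \<Longrightarrow> chart a z b \<in> T"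
    using T(2) unfolding open_dist by auto
  let ?a = "1 / f 0 + e / 2"
  have "chart ?a z b \<in> T" by (rule e(2)) (use e(1) in \<open>simp add: dist_real_def\<close>)
  moreover have "chart ?a z b \<in> B14_plus f" unfolding B14_plus_def using e(1) by force
  ultimately have "chart ?a z b = chart (1 / f 0) z b" by (rule T(3))
  then show False using e(1) by (simp add: chart_eq_iff)
qed

section \<open>Eigenvalues as functions on the chart\<close>

context sturm_liouville
begin

definition ev :: "nat \<Rightarrow> real \<Rightarrow> complex \<Rightarrow> real \<Rightarrow> real" where
  "ev n s z b = pencil_eigval {1..N} (rank_one_pert (R_form z b) 1 s) (P_form z) n"

definition ev_deg :: "nat \<Rightarrow> complex \<Rightarrow> real \<Rightarrow> real" where
  "ev_deg n z b = pencil_eigval {2..N} (R_form z b) (P_form z) n"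

lemma chart_nondegenerate:
  assumes "a \<noteq> 1 / f 0"
  shows "has_exactly_eigenvalues N f q w (chart a z b) N"
    and "length (eigenvalue_list N f q w (chart a z b)) = N"
    and "n < N \<Longrightarrow> eigval N f q w n (chart a z b) = ev n (- 1 / (a - 1 / f 0)) z b"
  using eigenvalues_nondegenerate[of "a - 1 / f 0" z b] assms by (auto simp: eigval_def ev_def)

lemma chart_degenerate:
  shows "has_exactly_eigenvalues N f q w (chart (1 / f 0) z b) (N - 1)"
    and "length (eigenvalue_list N f q w (chart (1 / f 0) z b)) = N - 1"
    and "n < N - 1 \<Longrightarrow> eigval N f q w n (chart (1 / f 0) z b) = ev_deg n z b"
  using eigenvalues_degenerate[of z b] by (auto simp: eigval_def ev_deg_def)

lemma tendsto_shear:
  "(\<zeta> \<longlongrightarrow> z) F \<Longrightarrow> ((\<lambda>t. shear (\<zeta> t) x n) \<longlongrightarrow> shear z x n) F"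
  by (cases "n = 1") (auto simp: shear_def intro!: tendsto_intros)

lemma tendsto_R_form:
  assumes "(\<zeta> \<longlongrightarrow> z) F" "(\<beta> \<longlongrightarrow> b) F"
  shows "((\<lambda>t. R_form (\<zeta> t) (\<beta> t) x v) \<longlongrightarrow> R_form z b x v) F"
  unfolding R_form_def using assms by (intro tendsto_intros tendsto_shear)

lemma tendsto_P_form:
  assumes "(\<zeta> \<longlongrightarrow> z) F"
  shows "((\<lambda>t. P_form (\<zeta> t) x v) \<longlongrightarrow> P_form z x v) F"
  unfolding P_form_def using assms by (intro tendsto_intros tendsto_shear)

lemma tendsto_ev:
  assumes "(\<sigma> \<longlongrightarrow> s) F" "(\<zeta> \<longlongrightarrow> z) F" "(\<beta> \<longlongrightarrow> b) F" "n < N"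
  shows "((\<lambda>t. ev n (\<sigma> t) (\<zeta> t) (\<beta> t)) \<longlongrightarrow> ev n s z b) F"
  unfolding ev_def
  by (rule tendsto_pencil_eigval[where Q = "\<lambda>t. rank_one_pert (R_form (\<zeta> t) (\<beta> t)) 1 (\<sigma> t)"
        and P = "\<lambda>t. P_form (\<zeta> t)"])
    (use assms in \<open>auto intro!: pencil_rank_one_pert pencil_sl tendsto_R_form tendsto_P_form tendsto_intros
      simp del: One_nat_def\<close>)

lemma tendsto_ev_deg:
  assumes "(\<zeta> \<longlongrightarrow> z) F" "(\<beta> \<longlongrightarrow> b) F" "n < N - 1"
  shows "((\<lambda>t. ev_deg n (\<zeta> t) (\<beta> t)) \<longlongrightarrow> ev_deg n z b) F"
  unfolding ev_deg_def
  by (rule tendsto_pencil_eigval[where Q = "\<lambda>t. R_form (\<zeta> t) (\<beta> t)" and P = "\<lambda>t. P_form (\<zeta> t)"])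
    (use assms in \<open>auto intro!: pencil_sl2 tendsto_R_form tendsto_P_form\<close>)

lemma card_2: "card {2..N} = N - 1"
  by simp

context
  fixes \<sigma> :: "'t \<Rightarrow> real" and \<zeta> :: "'t \<Rightarrow> complex" and \<beta> :: "'t \<Rightarrow> real" and z b F
  assumes \<zeta>: "(\<zeta> \<longlongrightarrow> z) F" and \<beta>: "(\<beta> \<longlongrightarrow> b) F"
begin

lemma rank_one_family:
  "pencil (insert 1 {2..N}) (R_form z b) (P_form z)"
  "\<And>t. pencil (insert 1 {2..N}) (R_form (\<zeta> t) (\<beta> t)) (P_form (\<zeta> t))"
  "1 \<notin> {2..N}"
  "\<And>i j. ((\<lambda>t. R_form (\<zeta> t) (\<beta> t) (unit_vec i) (unit_vec j)) \<longlongrightarrow> R_form z b (unit_vec i) (unit_vec j)) F"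
  "\<And>i j. ((\<lambda>t. P_form (\<zeta> t) (unit_vec i) (unit_vec j)) \<longlongrightarrow> P_form z (unit_vec i) (unit_vec j)) F"
  unfolding interval_insert[symmetric]
  using pencil_sl tendsto_R_form[OF \<zeta> \<beta>] tendsto_P_form[OF \<zeta>] by auto

lemma tendsto_ev_at_top:
  assumes "filterlim \<sigma> at_top F" "n < N - 1"
  shows "((\<lambda>t. ev n (\<sigma> t) (\<zeta> t) (\<beta> t)) \<longlongrightarrow> ev_deg n z b) F"
  unfolding ev_def ev_deg_def interval_insert
  by (rule tendsto_rank_one_pert_at_top[where R = "\<lambda>t. R_form (\<zeta> t) (\<beta> t)" and P = "\<lambda>t. P_form (\<zeta> t)"
        and P' = "P_form z", OF rank_one_family _ assms(1)]) (use assms(2) in simp)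

lemma tendsto_ev_at_bot:
  assumes "filterlim \<sigma> at_bot F" "1 \<le> n" "n \<le> N - 1"
  shows "((\<lambda>t. ev n (\<sigma> t) (\<zeta> t) (\<beta> t)) \<longlongrightarrow> ev_deg (n - 1) z b) F"
  unfolding ev_def ev_deg_def interval_insert
  by (rule tendsto_rank_one_pert_at_bot[where R = "\<lambda>t. R_form (\<zeta> t) (\<beta> t)" and P = "\<lambda>t. P_form (\<zeta> t)"
        and P' = "P_form z", OF rank_one_family assms(2) _ assms(1)]) (use assms(3) in simp)

lemma ev_last_at_top:
  assumes "filterlim \<sigma> at_top F"
  shows "filterlim (\<lambda>t. ev (N - 1) (\<sigma> t) (\<zeta> t) (\<beta> t)) at_top F"
  unfolding ev_def interval_insert card_2[symmetric]
  by (rule rank_one_pert_last_at_top[where R = "\<lambda>t. R_form (\<zeta> t) (\<beta> t)" and P = "\<lambda>t. P_form (\<zeta> t)"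
        and P' = "P_form z", OF rank_one_family assms])

lemma ev_first_at_bot:
  assumes "filterlim \<sigma> at_bot F"
  shows "filterlim (\<lambda>t. ev 0 (\<sigma> t) (\<zeta> t) (\<beta> t)) at_bot F"
  unfolding ev_def interval_insert
  by (rule rank_one_pert_first_at_bot[where R = "\<lambda>t. R_form (\<zeta> t) (\<beta> t)" and P = "\<lambda>t. P_form (\<zeta> t)"
        and P' = "P_form z", OF rank_one_family assms])

end

lemma ev_mono_s: "s \<le> s' \<Longrightarrow> n < N \<Longrightarrow> ev n s z b \<le> ev n s' z b"
  unfolding ev_def by (rule rank_one_pert_mono[OF pencil_sl]) auto

lemma ev_mono_b:
  assumes "b \<le> b'" "n < N"
  shows "ev n s z b \<le> ev n s z b'"
  unfolding ev_def
proof (rule pencil_eigval_le[OF pencil_rank_one_pert[OF pencil_sl] pencil_rank_one_pert[OF pencil_sl] order_refl])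
  show "n < card {1..N}" using assms by simp
  let ?\<mu> = "pencil_eigval {1..N} (rank_one_pert (R_form z b') 1 s) (P_form z) n"
  fix x assume "qf (rank_one_pert (R_form z b') 1 s) x \<le> ?\<mu> * qf (P_form z) x"
  moreover have "qf (R_form z b') x = qf (R_form z b) x + (b' - b) * (cmod (x N))\<^sup>2"
    by (simp add: qf_def R_form_def mult.assoc left_diff_distrib flip: complex_norm_square)
  moreover have "0 \<le> (b' - b) * (cmod (x N))\<^sup>2" using assms(1) by simp
  ultimately show "qf (rank_one_pert (R_form z b) 1 s) x \<le> ?\<mu> * qf (P_form z) x"
    unfolding qf_rank_one_pert by linarith
qed

text \<open>For \<open>z = 0\<close> the degenerate problem has a Dirichlet condition at \<open>n = 1\<close>, so a solution is determined by
  \<open>y\<^sub>2\<close> and all eigenvalues are simple.\<close>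

lemma ev_deg_simple:
  assumes n: "1 \<le> n" "n < N - 1"
  shows "ev_deg (n - 1) 0 0 \<noteq> ev_deg n 0 0"
proof
  assume eq: "ev_deg (n - 1) 0 0 = ev_deg n 0 0"
  let ?\<mu> = "pencil_eigval {2..N} (R_form 0 0) (P_form 0)"
  define l where "l = complex_of_real (?\<mu> n)"
  let ?J = "{i. i < card {2..N} \<and> of_real (?\<mu> i) = l}"
  note pc = pencil_sl2[of 0 0]
  obtain e where es: "full_eig_system {2..N} (R_form 0 0) (P_form 0) e ?\<mu>"
    using pencil_eigval[OF pc] .
  \<comment> \<open>Two coinciding eigenvalues give two unknown coefficients, enough for a
    nontrivial combination \<open>u\<close> with \<open>u 2 = 0\<close>.\<close>
  have "{n - 1, n} \<subseteq> ?J" using eq n by (auto simp: ev_deg_def l_def)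
  from card_mono[OF _ this] have "card {()} < card ?J" using n by simp
  then obtain c where c: "\<exists>j\<in>?J. c j \<noteq> 0" "(\<Sum>j\<in>?J. c j * e j 2) = 0"
    using homogeneous_system_solution[of "{()}" ?J "\<lambda>_ j. e j 2"] by auto
  define u where "u = (\<lambda>n. \<Sum>j\<in>?J. c j * e j n)"
  have u: "u \<in> {x \<in> vecs_on {2..N}. \<forall>v\<in>vecs_on {2..N}. R_form 0 0 x v = l * P_form 0 x v}"
    unfolding pencil_eigenspace[OF pc es] u_def by blast
  have "u \<noteq> 0"
  proof
    assume "u = 0"
    moreover obtain j where j: "j \<in> ?J" "c j \<noteq> 0" using c(1) by blast
    moreover have "P_form 0 u (e j) = c j"
      unfolding u_def by (subst eig_system_coeff[OF pc es]) (use j in auto)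
    ultimately show False using hermitian_zero[OF hermitian_P_form] by simp
  qed
  let ?y = "extension 0 0 u (multiplier l 0 u)"
  have res: "residual l ?y k = 0" if "k \<in> {1..N}" for k
    using residual_degenerate_iff[of l 0 0 u] u that by blast
  have y: "?y k = u k" if "1 \<le> k" "k \<le> N" for k
    using that by (simp add: extension_simps(2) shear_def)
  \<comment> \<open>Two consecutive zeros propagate: the equation at \<open>k + 1\<close> reduces to
    \<open>f (k + 1) * u (k + 2) = 0\<close>.\<close>
  have "u k = 0 \<and> u (k + 1) = 0" if "1 \<le> k" "k + 1 \<le> N" for k
    using that
  proof (induction k rule: dec_induct)
    case base
    have "u 1 = 0" using u by (auto simp: vecs_on_def)
    moreover have "u 2 = 0" using c(2) by (simp add: u_def)
    ultimately show ?case by (simp add: numeral_2_eq_2)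
  next
    case (step k)
    then have IH: "u k = 0" "u (k + 1) = 0" by auto
    have "residual l ?y (k + 1) = - of_real (f (k + 1)) * u (k + 2)"
      unfolding residual_def using step.prems step.hyps IH y[of k] y[of "k + 1"] y[of "k + 2"] by simp
    then have "u (k + 2) = 0" using res[of "k + 1"] f_nonzero[of "k + 1"] step.prems by simp
    then show ?case using IH by simp
  qed
  note uz = this
  have "u k = 0" for k
  proof (cases "k \<in> {2..N}")
    case True
    then show ?thesis using uz[of "k - 1"] by auto
  next
    case False
    then show ?thesis using u by (auto simp: vecs_on_def)
  qed
  with \<open>u \<noteq> 0\<close> show False by (auto simp: fun_eq_iff)
qed

abbreviation "a_of C \<equiv> Re (coord 2 4 C)"
abbreviation "z_of C \<equiv> coord 1 2 C"
abbreviation "b_of C \<equiv> Re (coord 1 3 C)"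
abbreviation "s_of C \<equiv> - 1 / (a_of C - 1 / f 0)"
abbreviation "eigv \<equiv> eigval N f q w"

lemma chart_sets:
  "C \<in> O14 \<Longrightarrow> chart (a_of C) (z_of C) (b_of C) = C"
  "C \<in> B14 f \<longleftrightarrow> C \<in> O14 \<and> a_of C = 1 / f 0"
  "C \<in> B14_plus f \<longleftrightarrow> C \<in> O14 \<and> a_of C > 1 / f 0"
  "C \<in> B14_minus f \<longleftrightarrow> C \<in> O14 \<and> a_of C < 1 / f 0"
  unfolding O14_def B14_def B14_plus_def B14_minus_def
  by (auto simp: coord_chart) blast+

lemma eigv_nondegenerate: "C \<in> O14 \<Longrightarrow> a_of C \<noteq> 1 / f 0 \<Longrightarrow> n < N \<Longrightarrow> eigv n C = ev n (s_of C) (z_of C) (b_of C)"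
  using chart_nondegenerate(3)[of "a_of C" n "z_of C" "b_of C"] chart_sets(1)[of C] by simp

lemma eigv_degenerate: "C \<in> B14 f \<Longrightarrow> n < N - 1 \<Longrightarrow> eigv n C = ev_deg n (z_of C) (b_of C)"
  using chart_degenerate(3)[of n "z_of C" "b_of C"] chart_sets(1,2)[of C] by simp

lemma tendsto_eigv_nondegenerate:
  assumes a: "a \<noteq> 1 / f 0" and S: "S \<subseteq> O14" and n: "n < N"
  shows "(eigv n \<longlongrightarrow> eigv n (chart a z b)) (atin_within bc_topology (chart a z b) S)"
proof (rule Lim_transform_eventually)
  note lims = tendsto_chart_coordinates[where a = a and z = z and b = b and S = S]
  show "((\<lambda>C. ev n (s_of C) (z_of C) (b_of C)) \<longlongrightarrow> eigv n (chart a z b))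
      (atin_within bc_topology (chart a z b) S)"
    unfolding chart_nondegenerate(3)[OF a n]
    by (intro tendsto_ev tendsto_intros lims n) (use a in simp)
  have "\<forall>\<^sub>F C in atin_within bc_topology (chart a z b) S. a_of C \<noteq> 1 / f 0"
    by (rule tendsto_imp_eventually_ne[OF lims(1) a])
  with eventually_atin_within_mem
  show "\<forall>\<^sub>F C in atin_within bc_topology (chart a z b) S. ev n (s_of C) (z_of C) (b_of C) = eigv n C"
    by eventually_elim (use S n eigv_nondegenerate in auto)
qed

section \<open>Limits at the boundary conditions with \<open>a12 = 1 / f 0\<close>\<close>

context
  fixes z :: complex and b :: real
begin

abbreviation "Fm \<equiv> atin_within bc_topology (chart (1 / f 0) z b) (B14_minus f)"
abbreviation "Fp \<equiv> atin_within bc_topology (chart (1 / f 0) z b) (B14_plus f)"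

lemma s_of_at_top: "filterlim (\<lambda>C. s_of C) at_top Fm"
proof -
  have "((\<lambda>C. 1 / f 0 - a_of C) \<longlongrightarrow> 1 / f 0 - 1 / f 0) Fm"
    by (intro tendsto_intros tendsto_chart_coordinates)
  moreover have "\<forall>\<^sub>F C in Fm. 0 < 1 / f 0 - a_of C"
    using eventually_atin_within_mem by eventually_elim (simp add: chart_sets)
  ultimately have "filterlim (\<lambda>C. inverse (1 / f 0 - a_of C)) at_top Fm"
    by (intro filterlim_inverse_at_top) simp_all
  moreover have "inverse (1 / f 0 - a_of C) = s_of C" for C
    by (metis inverse_eq_divide minus_diff_eq minus_divide_left minus_divide_right)
  ultimately show ?thesis by simp
qed

lemma s_of_at_bot: "filterlim (\<lambda>C. s_of C) at_bot Fp"
proof -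
  have "((\<lambda>C. 1 / f 0 - a_of C) \<longlongrightarrow> 1 / f 0 - 1 / f 0) Fp"
    by (intro tendsto_intros tendsto_chart_coordinates)
  moreover have "\<forall>\<^sub>F C in Fp. 1 / f 0 - a_of C < 0"
    using eventually_atin_within_mem by eventually_elim (simp add: chart_sets)
  ultimately have "filterlim (\<lambda>C. inverse (1 / f 0 - a_of C)) at_bot Fp"
    by (intro filterlim_inverse_at_bot) simp_all
  moreover have "inverse (1 / f 0 - a_of C) = s_of C" for C
    by (metis inverse_eq_divide minus_diff_eq minus_divide_left minus_divide_right)
  ultimately show ?thesis by simp
qed

lemma eventually_eigv:
  assumes "n < N"
  shows "\<forall>\<^sub>F C in Fm. ev n (s_of C) (z_of C) (b_of C) = eigv n C"
    and "\<forall>\<^sub>F C in Fp. ev n (s_of C) (z_of C) (b_of C) = eigv n C"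
proof -
  show "\<forall>\<^sub>F C in Fm. ev n (s_of C) (z_of C) (b_of C) = eigv n C"
    using eventually_atin_within_mem by eventually_elim (simp add: chart_sets eigv_nondegenerate assms)
  show "\<forall>\<^sub>F C in Fp. ev n (s_of C) (z_of C) (b_of C) = eigv n C"
    using eventually_atin_within_mem by eventually_elim (simp add: chart_sets eigv_nondegenerate assms)
qed

text \<open>Two different mechanisms with the same limit: the growing penalty along
  \<open>B14_minus\<close>, and continuity of the restricted pencil along
  \<open>B14\<close>.\<close>

lemma tendsto_eigv_minus_Un:
  assumes n: "n < N - 1"
  shows "(eigv n \<longlongrightarrow> eigv n (chart (1 / f 0) z b))
    (atin_within bc_topology (chart (1 / f 0) z b) (B14_minus f \<union> B14 f))"
  unfolding chart_degenerate(3)[OF n]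
proof (rule filterlim_atin_within_Un)
  show "(eigv n \<longlongrightarrow> ev_deg n z b) Fm"
    by (rule Lim_transform_eventually[OF
          tendsto_ev_at_top[OF tendsto_chart_coordinates(2,3) s_of_at_top n] eventually_eigv(1)])
      (use n in simp)
  show "(eigv n \<longlongrightarrow> ev_deg n z b) (atin_within bc_topology (chart (1 / f 0) z b) (B14 f))"
  proof (rule Lim_transform_eventually[OF tendsto_ev_deg[OF tendsto_chart_coordinates(2,3) n]])
    show "\<forall>\<^sub>F C in atin_within bc_topology (chart (1 / f 0) z b) (B14 f).
        ev_deg n (z_of C) (b_of C) = eigv n C"
      using eventually_atin_within_mem by eventually_elim (use n eigv_degenerate in simp)
  qed
qed

lemma eigv_last_at_top: "filterlim (eigv (N - 1)) at_top Fm"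
proof -
  have "filterlim (\<lambda>C. ev (N - 1) (s_of C) (z_of C) (b_of C)) at_top Fm"
    by (rule ev_last_at_top[OF tendsto_chart_coordinates(2,3) s_of_at_top])
  then show ?thesis
    by (rule filterlim_cong[OF refl refl eventually_eigv(1), THEN iffD1, rotated]) (use N2 in simp)
qed

lemma eigv_first_at_bot: "filterlim (eigv 0) at_bot Fp"
proof -
  have "filterlim (\<lambda>C. ev 0 (s_of C) (z_of C) (b_of C)) at_bot Fp"
    by (rule ev_first_at_bot[OF tendsto_chart_coordinates(2,3) s_of_at_bot])
  then show ?thesis
    by (rule filterlim_cong[OF refl refl eventually_eigv(2), THEN iffD1, rotated]) (use N2 in simp)
qed

lemma tendsto_eigv_plus:
  assumes n: "1 \<le> n" "n \<le> N - 1"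
  shows "(eigv n \<longlongrightarrow> eigv (n - 1) (chart (1 / f 0) z b)) Fp"
proof -
  have n': "n - 1 < N - 1" "n < N" using n N2 by auto
  show ?thesis
    unfolding chart_degenerate(3)[OF n'(1)]
    by (rule Lim_transform_eventually[OF
          tendsto_ev_at_bot[OF tendsto_chart_coordinates(2,3) s_of_at_bot n] eventually_eigv(2)[OF n'(2)]])
qed

text \<open>Continuity is contradicted along \<open>B14_plus\<close>, where the limit is
  \<open>\<lambda>\<close> with index \<open>n - 1\<close>, or minus infinity for
  \<open>n = 0\<close>. For \<open>n = N - 1\<close> the function is undefined at the point
  itself.\<close>

lemma not_eigval_continuous_at:
  assumes n: "n < N"
    and gap: "n = 0 \<or> n = N - 1 \<or> eigv (n - 1) (chart (1 / f 0) z b) \<noteq> eigv n (chart (1 / f 0) z b)"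
  shows "\<not> eigval_continuous_at N f q w n (chart (1 / f 0) z b)"
proof
  let ?A = "chart (1 / f 0) z b" and ?D = "eigval_domain N f q w n"
  assume "eigval_continuous_at N f q w n ?A"
  then have top: "?A \<in> ?D" and "limitin euclideanreal (eigv n) (eigv n ?A) (atin (subtopology bc_topology ?D) ?A)"
    unfolding eigval_continuous_at_def topcontinuous_at_atin by auto
  then have "limitin euclideanreal (eigv n) (eigv n ?A) (atin_within bc_topology ?A ?D)"
    by (simp add: atin_subtopology_within)
  then have "limitin euclideanreal (eigv n) (eigv n ?A) Fp"
  proof (rule limit_within_subset)
    show "B14_plus f \<subseteq> ?D"
      unfolding B14_plus_def eigval_domain_def using chart_self_adjoint n
      by (auto simp: chart_nondegenerate(2))
  qed
  then have lim: "(eigv n \<longlongrightarrow> eigv n ?A) Fp" by simp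
  \<comment> \<open>Being defined at a point with only \<open>N - 1\<close> eigenvalues rules out
    \<open>n = N - 1\<close>.\<close>
  have "n < N - 1" using top unfolding eigval_domain_def by (simp add: chart_degenerate(2))
  show False
  proof (cases "n = 0")
    case True
    then show ?thesis
      using not_tendsto_and_filterlim_at_infinity[OF B14_plus_nontrivial lim]
        filterlim_at_bot_imp_at_infinity[OF eigv_first_at_bot] by simp
  next
    case False
    then have "(eigv n \<longlongrightarrow> eigv (n - 1) ?A) Fp" using tendsto_eigv_plus n by simp
    then have "eigv (n - 1) ?A = eigv n ?A"
      using tendsto_unique[OF B14_plus_nontrivial _ lim] by blast
    with gap False \<open>n < N - 1\<close> show False by simp
  qed
qed

end

lemma continuous_map_eigvI:
  assumes "S \<subseteq> O14" "\<And>C. C \<in> S \<Longrightarrow> (eigv n \<longlongrightarrow> eigv n C) (atin_within bc_topology C S)"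
  shows "continuous_map (subtopology bc_topology S) euclideanreal (eigv n)"
  unfolding continuous_map_atin using assms by (simp add: atin_subtopology_within)

end

theorem theorem4p1:
  fixes N :: nat and f q w :: "nat \<Rightarrow> real"
  assumes "N \<ge> 2"
    and "\<And>n. n \<le> N \<Longrightarrow> f n \<noteq> 0"
    and "\<And>n. 1 \<le> n \<Longrightarrow> n \<le> N \<Longrightarrow> w n > 0"
  shows "(\<forall>A\<in>B14 f. has_exactly_eigenvalues N f q w A (N - 1))
    \<and> (\<forall>A\<in>O14 - B14 f. has_exactly_eigenvalues N f q w A N)
    \<and> (\<forall>n<N. continuous_map (subtopology bc_topology (O14 - B14 f)) euclideanreal
          (eigval N f q w n))
    \<and> (\<forall>n<N. \<forall>S\<in>{B14_plus f, B14_minus f}.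
          (\<forall>a a' z b. chart a z b \<in> S \<and> chart a' z b \<in> S \<and> a \<le> a' \<longrightarrow>
             eigval N f q w n (chart a z b) \<le> eigval N f q w n (chart a' z b)) \<and>
          (\<forall>a z b b'. chart a z b \<in> S \<and> chart a z b' \<in> S \<and> b \<le> b' \<longrightarrow>
             eigval N f q w n (chart a z b) \<le> eigval N f q w n (chart a z b')))
    \<and> (\<forall>n<N. \<exists>A\<^sub>0\<in>B14 f. \<not> eigval_continuous_at N f q w n A\<^sub>0)
    \<and> (\<forall>A\<^sub>0\<in>B14 f.
          (\<forall>n<N. n = 0 \<or> n = N - 1 \<or> eigval N f q w (n - 1) A\<^sub>0 \<noteq> eigval N f q w n A\<^sub>0 \<longrightarrow>
             \<not> eigval_continuous_at N f q w n A\<^sub>0) \<and>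
          (\<forall>n\<le>N - 2.
             (eigval N f q w n \<longlongrightarrow> eigval N f q w n A\<^sub>0)
               (atin_within bc_topology A\<^sub>0 (B14_minus f \<union> B14 f))) \<and>
          filterlim (eigval N f q w (N - 1)) at_top
            (atin_within bc_topology A\<^sub>0 (B14_minus f)) \<and>
          filterlim (eigval N f q w 0) at_bot
            (atin_within bc_topology A\<^sub>0 (B14_plus f)) \<and>
          (\<forall>n. 1 \<le> n \<and> n \<le> N - 1 \<longrightarrow>
             (eigval N f q w n \<longlongrightarrow> eigval N f q w (n - 1) A\<^sub>0)
               (atin_within bc_topology A\<^sub>0 (B14_plus f))))
    \<and> (\<forall>n\<le>N - 2. continuous_map (subtopology bc_topology (B14_minus f \<union> B14 f)) euclideanreal
          (eigval N f q w n))"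
proof -
  interpret sturm_liouville N f q w
    using assms by unfold_locales auto
  have N: "0 < N" using assms(1) by simp
  have B14E: "\<exists>z b. A = chart (1 / f 0) z b" if "A \<in> B14 f" for A
    using that unfolding B14_def by auto
  have nondeg: "\<exists>a z b. A = chart a z b \<and> a \<noteq> 1 / f 0" if "A \<in> O14 - B14 f" for A
    using that unfolding O14_def B14_def by auto
  have exact0: "has_exactly_eigenvalues N f q w A (N - 1)" if "A \<in> B14 f" for A
    using B14E[OF that] chart_degenerate(1) by auto
  have exact: "has_exactly_eigenvalues N f q w A N" if "A \<in> O14 - B14 f" for A
    using nondeg[OF that] chart_nondegenerate(1) by auto
  have cont: "continuous_map (subtopology bc_topology (O14 - B14 f)) euclideanreal (eigv n)" if "n < N" for n
  proof (rule continuous_map_eigvI)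
    fix C assume "C \<in> O14 - B14 f"
    from nondeg[OF this] show "(eigv n \<longlongrightarrow> eigv n C) (atin_within bc_topology C (O14 - B14 f))"
      using tendsto_eigv_nondegenerate[of _ "O14 - B14 f" n] that by auto
  qed simp
  have mono_a: "eigv n (chart a z b) \<le> eigv n (chart a' z b)"
    and mono_b: "b \<le> b' \<Longrightarrow> eigv n (chart a z b) \<le> eigv n (chart a z b')"
    if "n < N" "a \<le> a'" and side: "1 / f 0 < a \<or> a' < 1 / f 0" for n a a' z b b'
  proof -
    \<comment> \<open>The product is positive because \<open>a\<close> and \<open>a'\<close> lie on
      the same side of the pole, where \<open>- 1 / (a - 1 / f 0)\<close> is increasing in
      \<open>a\<close>.\<close>
    have "a \<noteq> 1 / f 0" "a' \<noteq> 1 / f 0" "0 < (a - 1 / f 0) * (a' - 1 / f 0)"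
      using side that(2) by (auto intro: mult_pos_pos mult_neg_neg)
    note ne = this
    have "- 1 / (a - 1 / f 0) \<le> - 1 / (a' - 1 / f 0)"
      using that(2) divide_left_mono[of "a - 1 / f 0" "a' - 1 / f 0" 1] ne(3) by (simp add: mult.commute)
    then show "eigv n (chart a z b) \<le> eigv n (chart a' z b)"
      unfolding chart_nondegenerate(3)[OF ne(1) that(1)] chart_nondegenerate(3)[OF ne(2) that(1)]
      by (rule ev_mono_s) fact
    show "b \<le> b' \<Longrightarrow> eigv n (chart a z b) \<le> eigv n (chart a z b')"
      unfolding chart_nondegenerate(3)[OF ne(1) that(1)] by (rule ev_mono_b) (use that in auto)
  qed
  have side: "chart a z b \<in> B14_plus f \<longleftrightarrow> 1 / f 0 < a" "chart a z b \<in> B14_minus f \<longleftrightarrow> a < 1 / f 0" for a z b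
    unfolding B14_plus_def B14_minus_def by (auto simp: chart_eq_iff)
  have disc: "\<exists>A\<in>B14 f. \<not> eigval_continuous_at N f q w n A" if n: "n < N" for n
  proof
    \<comment> \<open>At \<open>z = 0\<close> and \<open>b = 0\<close> the eigenvalues are simple,
      so this one point witnesses discontinuity for every \<open>n\<close>.\<close>
    show "chart (1 / f 0) 0 0 \<in> B14 f" unfolding B14_def by blast
    have "n = 0 \<or> n = N - 1 \<or> eigv (n - 1) (chart (1 / f 0) 0 0) \<noteq> eigv n (chart (1 / f 0) 0 0)"
      using ev_deg_simple[of n] n chart_degenerate(3)[of n 0 0] chart_degenerate(3)[of "n - 1" 0 0] by force
    then show "\<not> eigval_continuous_at N f q w n (chart (1 / f 0) 0 0)"
      by (rule not_eigval_continuous_at[OF n])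
  qed
  have cont0: "continuous_map (subtopology bc_topology (B14_minus f \<union> B14 f)) euclideanreal (eigv n)"
    if "n < N - 1" for n
  proof (rule continuous_map_eigvI)
    show sub: "B14_minus f \<union> B14 f \<subseteq> O14" unfolding B14_minus_def B14_def O14_def by blast
    fix C assume C: "C \<in> B14_minus f \<union> B14 f"
    show "(eigv n \<longlongrightarrow> eigv n C) (atin_within bc_topology C (B14_minus f \<union> B14 f))"
    proof (cases "C \<in> B14 f")
      case True
      then show ?thesis using B14E tendsto_eigv_minus_Un[OF that] by blast
    next
      case False
      then obtain a z b where "C = chart a z b" "a \<noteq> 1 / f 0" using C unfolding B14_minus_def by auto
      then show ?thesis using tendsto_eigv_nondegenerate[OF _ sub] that by simp
    qed
  qed
  show ?thesis
  proof (intro conjI ballI allI impI)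
    fix A n assume "A \<in> B14 f" "n \<le> N - 2"
    then show "(eigv n \<longlongrightarrow> eigv n A) (atin_within bc_topology A (B14_minus f \<union> B14 f))"
      using B14E tendsto_eigv_minus_Un[of n] assms(1) by fastforce
  next
    fix A n assume "A \<in> B14 f" "n < N" "n = 0 \<or> n = N - 1 \<or> eigv (n - 1) A \<noteq> eigv n A"
    then show "\<not> eigval_continuous_at N f q w n A"
      using B14E not_eigval_continuous_at[of n] by blast
  next
    fix A assume "A \<in> B14 f"
    then show "filterlim (eigv (N - 1)) at_top (atin_within bc_topology A (B14_minus f))"
      "filterlim (eigv 0) at_bot (atin_within bc_topology A (B14_plus f))"
      using B14E eigv_last_at_top eigv_first_at_bot by blast+
  next
    fix A n assume "A \<in> B14 f" "1 \<le> n \<and> n \<le> N - 1"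
    then show "(eigv n \<longlongrightarrow> eigv (n - 1) A) (atin_within bc_topology A (B14_plus f))"
      using B14E tendsto_eigv_plus[of n] by blast
  next
    fix n S a a' z b
    assume "n < N" "S \<in> {B14_plus f, B14_minus f}" "chart a z b \<in> S \<and> chart a' z b \<in> S \<and> a \<le> a'"
    then show "eigv n (chart a z b) \<le> eigv n (chart a' z b)"
      by (intro mono_a) (auto simp: side)
  next
    fix n S a z b b'
    assume "n < N" "S \<in> {B14_plus f, B14_minus f}" "chart a z b \<in> S \<and> chart a z b' \<in> S \<and> b \<le> b'"
    then show "eigv n (chart a z b) \<le> eigv n (chart a z b')"
      by (intro mono_b[where a' = a]) (auto simp: side)
  qed (use exact0 exact cont disc cont0 assms(1) in auto)
qed

end
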